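(* Let $p$ be a prime and $n\ge 1$. Let $A_1,A_2,\ldots\in\mathrm{GL}_n(\mathbb{Q}_p)$ be independent random matrices (not necessarily identically distributed), each with distribution invariant under left- and right-multiplication by $\mathrm{GL}_n(\mathbb{Z}_p)$, defined on a common product probability space $\Omega$. For $1\le i\le n$ and $k\ge 1$ let $A_k^{(i)}\in\mathrm{Mat}_{(n-i+1)\times n}(\mathbb{Q}_p)$ be the submatrix of $A_k$ consisting of its last $n-i+1$ rows and all $n$ columns. Define $\lambda(0)=(0,\ldots,0)\in\mathbb{Z}^n$ and, for $k\ge 1$, $$\lambda(k)=(\lambda_1(k),\ldots,\lambda_n(k))=\mathrm{SN}\big(\mathrm{diag}_{n\times n}(p^{\lambda_1(k-1)},\ldots,p^{\lambda_n(k-1)})\,A_k\big).$$ Define $v(k)=(v_1(k),\ldots,v_n(k))\in\mathbb{Z}^n$, $k\ge 0$, by $$v_i(k)+\cdots+v_n(k)=\sum_{j=1}^k|\mathrm{SN}(A_j^{(i)})|\qquad (1\le i\le n).$$ Suppose that $v$ is split, i.e. for all $1\le i\le n-1$, $$\lim_{k\to\infty}\big(v_i(k)-v_{i+1}(k+1)+\mathrm{SN}(A_{k+1})_n\big)=+\infty .$$ Then for every $1\le i\le n$, $$\sup_{k\in\mathbb{Z}_{\ge 0}}|\lambda_i(k)-v_i(k)|<\infty .$$ Here both the hypothesis and the conclusion are understood pointwise, for a given outcome in $\Omega$ (the bound may depend on the outcome).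
   Context: For $n\le m$, a matrix $A\in\mathrm{Mat}_{n\times m}(\mathbb{Q}_p)$ is called nonsingular if it has rank $n$. By Cartan decomposition (Smith normal form), such an $A$ can be written $A=U\,\mathrm{diag}_{n\times m}(p^{\lambda_1},\ldots,p^{\lambda_n})V$ with $U\in\mathrm{GL}_n(\mathbb{Z}_p)$, $V\in\mathrm{GL}_m(\mathbb{Z}_p)$ and unique integers $\lambda_1\ge\cdots\ge\lambda_n$. These are the singular numbers of $A$, written $\mathrm{SN}(A)=(\lambda_1,\ldots,\lambda_n)$, and $\mathrm{SN}(A)_i:=\lambda_i$; in particular $\mathrm{SN}(A)_n$ is the smallest one. For an integer tuple $\lambda$, $|\lambda|$ denotes the sum of its entries (the weight). In $|\lambda_i(k)-v_i(k)|$ the bars denote the usual absolute value of an integer. The tuple $v(k)$ need not be non-increasing. *)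

theory Defs
  imports
    "HOL-Probability.Probability"
    "HOL-Computational_Algebra.Fraction_Field"
    "Berlekamp_Zassenhaus.Finite_Field"
    "Jordan_Normal_Form.DL_Submatrix"
begin

text \<open>
  The prime \<open>p\<close> is carried by a type \<open>'p\<close> of class \<open>prime_card\<close>, as \<open>p = CARD('p)\<close>.
  The ring \<open>\<int>\<^sub>p\<close> is the inverse limit of the rings \<open>\<int>/p^n\<close>, an element being the sequence of its
  canonical residues: coherence forces \<open>f n\<close> to lie in \<open>{0..<p^n}\<close>.
\<close>

typedef (overloaded) 'p padic_int =
  "{f :: nat \<Rightarrow> int. \<forall>n. f (Suc n) mod int CARD('p::prime_card) ^ n = f n}"
  morphisms residue Abs_padic_int
  by (rule exI[of _ "\<lambda>_. 0"]) simp

setup_lifting type_definition_padic_int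

lemma mod_mult_power_mod_power [simp]: "a mod (q * q ^ n) mod q ^ n = a mod (q::int) ^ n"
  by (rule mod_mod_cancel) simp

lemma residue_Suc_mod:
  "residue (x :: 'p::prime_card padic_int) (Suc n) mod int CARD('p) ^ n = residue x n"
  using residue[of x] by simp

lemma residue_mod:
  assumes "n \<le> m"
  shows "residue (x :: 'p::prime_card padic_int) m mod int CARD('p) ^ n = residue x n"
  using assms
proof (induction m rule: dec_induct)
  case base
  have "residue x n = residue x (Suc n) mod int CARD('p) ^ n"
    by (simp add: residue_Suc_mod)
  then show ?case by simp
next
  case (step m)
  have "residue x (Suc m) mod int CARD('p) ^ n
      = residue x (Suc m) mod int CARD('p) ^ m mod int CARD('p) ^ n"
    using step.hyps by (simp add: mod_mod_cancel le_imp_power_dvd)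
  then show ?case using step.IH by (simp add: residue_Suc_mod)
qed

instantiation padic_int :: (prime_card) comm_ring_1
begin

lift_definition zero_padic_int :: "'a padic_int" is "\<lambda>_. 0" by simp

lift_definition one_padic_int :: "'a padic_int" is "\<lambda>n. 1 mod int CARD('a) ^ n"
  by simp

lift_definition plus_padic_int :: "'a padic_int \<Rightarrow> 'a padic_int \<Rightarrow> 'a padic_int"
  is "\<lambda>f g n. (f n + g n) mod int CARD('a) ^ n"
  by (simp, metis mod_add_eq)

lift_definition uminus_padic_int :: "'a padic_int \<Rightarrow> 'a padic_int"
  is "\<lambda>f n. (- f n) mod int CARD('a) ^ n"
  by (simp, metis mod_minus_eq)

lift_definition minus_padic_int :: "'a padic_int \<Rightarrow> 'a padic_int \<Rightarrow> 'a padic_int"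
  is "\<lambda>f g n. (f n - g n) mod int CARD('a) ^ n"
  by (simp, metis mod_diff_eq)

lift_definition times_padic_int :: "'a padic_int \<Rightarrow> 'a padic_int \<Rightarrow> 'a padic_int"
  is "\<lambda>f g n. (f n * g n) mod int CARD('a) ^ n"
  by (simp, metis mod_mult_eq)

instance
proof
  fix a b c :: "'a padic_int"
  note eq_residue = residue_inject [symmetric] fun_eq_iff residue_mod
    zero_padic_int.rep_eq one_padic_int.rep_eq plus_padic_int.rep_eq uminus_padic_int.rep_eq
    minus_padic_int.rep_eq times_padic_int.rep_eq
  show "a + b + c = a + (b + c)"
    by (simp add: eq_residue add_ac mult_ac ring_distribs mod_simps)
  show "a + b = b + a"
    by (simp add: eq_residue add_ac mult_ac ring_distribs mod_simps)
  show "0 + a = a"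
    by (simp add: eq_residue add_ac mult_ac ring_distribs mod_simps)
  show "- a + a = 0"
    by (simp add: eq_residue add_ac mult_ac ring_distribs mod_simps)
  show "a - b = a + - b"
    by (simp add: eq_residue add_ac mult_ac ring_distribs mod_simps)
  show "a * b * c = a * (b * c)"
    by (simp add: eq_residue add_ac mult_ac ring_distribs mod_simps)
  show "a * b = b * a"
    by (simp add: eq_residue add_ac mult_ac ring_distribs mod_simps)
  show "1 * a = a"
    by (simp add: eq_residue add_ac mult_ac ring_distribs mod_simps)
  show "(a + b) * c = a * c + b * c"
    by (simp add: eq_residue add_ac mult_ac ring_distribs mod_simps)
  have "(1::int) mod int CARD('a) ^ 1 = 1"
    using prime_gt_1_nat[OF prime_card[where 'a='a]] by simp
  then have "residue (1::'a padic_int) 1 \<noteq> residue 0 1"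
    by (simp only: one_padic_int.rep_eq zero_padic_int.rep_eq)
  then show "(0::'a padic_int) \<noteq> 1"
    by metis
qed

end

instance padic_int :: (prime_card) idom
proof
  fix a b :: "'a padic_int"
  let ?p = "int CARD('a)"
  assume "a \<noteq> 0" "b \<noteq> 0"
  then obtain m n where m: "residue a m \<noteq> 0" and n: "residue b n \<noteq> 0"
    unfolding residue_inject [symmetric] zero_padic_int.rep_eq fun_eq_iff by blast
  have p: "prime ?p" using prime_card[where 'a='a] by simp
  have "\<not> ?p ^ m dvd residue a (m + n)"
    using m residue_mod[of m "m + n" a] by (auto simp: dvd_eq_mod_eq_0)
  moreover have "\<not> ?p ^ n dvd residue b (m + n)"
    using n residue_mod[of n "m + n" b] by (auto simp: dvd_eq_mod_eq_0)
  moreover have "?p ^ m dvd residue a (m + n) \<or> ?p ^ n dvd residue b (m + n)"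
    if dvd: "?p ^ (m + n) dvd residue a (m + n) * residue b (m + n)"
  proof -
    obtain r s where "r + s = m + n"
      and r: "?p ^ r dvd residue a (m + n)" and s: "?p ^ s dvd residue b (m + n)"
      using prime_elem_power_dvd_prod[OF dvd prime_imp_prime_elem[OF p]] by blast
    then have "m \<le> r \<or> n \<le> s" by linarith
    then show ?thesis using r s by (meson power_le_dvd)
  qed
  ultimately have "\<not> ?p ^ (m + n) dvd residue a (m + n) * residue b (m + n)"
    by blast
  then have "residue (a * b) (m + n) \<noteq> 0"
    by (simp add: times_padic_int.rep_eq dvd_eq_mod_eq_0)
  then show "a * b \<noteq> 0"
    using zero_padic_int.rep_eq by metis
qed

text \<open>\<open>\<rat>\<^sub>p\<close> is the fraction field of \<open>\<int>\<^sub>p\<close>, copied to a type of its own to carry its topology.\<close>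

typedef (overloaded) 'p padic = "UNIV :: 'p::prime_card padic_int fract set"
  morphisms fract_of_padic padic_of_fract
  by simp

setup_lifting type_definition_padic

instantiation padic :: (prime_card) field
begin

lift_definition zero_padic :: "'a padic" is 0 .
lift_definition one_padic :: "'a padic" is 1 .
lift_definition plus_padic :: "'a padic \<Rightarrow> 'a padic \<Rightarrow> 'a padic" is "(+)" .
lift_definition uminus_padic :: "'a padic \<Rightarrow> 'a padic" is uminus .
lift_definition minus_padic :: "'a padic \<Rightarrow> 'a padic \<Rightarrow> 'a padic" is "(-)" .
lift_definition times_padic :: "'a padic \<Rightarrow> 'a padic \<Rightarrow> 'a padic" is "(*)" .
lift_definition inverse_padic :: "'a padic \<Rightarrow> 'a padic" is inverse .
lift_definition divide_padic :: "'a padic \<Rightarrow> 'a padic \<Rightarrow> 'a padic" is "(/)" .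

instance
  by standard (transfer; simp add: algebra_simps divide_inverse)+

end

definition of_padic_int :: "'p::prime_card padic_int \<Rightarrow> 'p padic" where
  "of_padic_int x = padic_of_fract (Fract x 1)"

lemma fract_of_padic_of_padic_int: "fract_of_padic (of_padic_int x) = Fract x 1"
  by (simp add: of_padic_int_def padic_of_fract_inverse)

lemma of_padic_int_0: "of_padic_int 0 = 0"
  by (simp add: fract_of_padic_inject [symmetric] fract_of_padic_of_padic_int
      zero_padic.rep_eq Zero_fract_def)

lemma of_padic_int_1: "of_padic_int 1 = 1"
  by (simp add: fract_of_padic_inject [symmetric] fract_of_padic_of_padic_int
      one_padic.rep_eq One_fract_def)

lemma of_padic_int_add: "of_padic_int (a + b) = of_padic_int a + of_padic_int b"
  by (simp add: fract_of_padic_inject [symmetric] fract_of_padic_of_padic_int plus_padic.rep_eq)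

lemma of_padic_int_mult: "of_padic_int (a * b) = of_padic_int a * of_padic_int b"
  by (simp add: fract_of_padic_inject [symmetric] fract_of_padic_of_padic_int times_padic.rep_eq)

lemma of_padic_int_of_nat: "of_padic_int (of_nat i) = of_nat i"
  by (induction i) (simp_all add: of_padic_int_0 of_padic_int_1 of_padic_int_add)

lemma of_padic_int_power: "of_padic_int (a ^ k) = of_padic_int a ^ k"
  by (induction k) (simp_all add: of_padic_int_1 of_padic_int_mult)

text \<open>The \<open>p\<close>-adic topology: the cosets \<open>x + p^k \<int>\<^sub>p\<close> form a neighbourhood base at \<open>x\<close>.\<close>

instantiation padic :: (prime_card) topological_space
begin

definition open_padic :: "'a padic set \<Rightarrow> bool" where
  "open_padic S \<longleftrightarrow> (\<forall>x\<in>S. \<exists>k::nat. \<forall>z. x + of_nat CARD('a) ^ k * of_padic_int z \<in> S)"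

instance
proof
  show "open (UNIV :: 'a padic set)"
    by (simp add: open_padic_def)
next
  fix S T :: "'a padic set"
  assume S: "open S" and T: "open T"
  show "open (S \<inter> T)"
    unfolding open_padic_def
  proof
    fix x assume x: "x \<in> S \<inter> T"
    obtain k where k: "\<And>z. x + of_nat CARD('a) ^ k * of_padic_int z \<in> S"
      using S x unfolding open_padic_def by blast
    obtain l where l: "\<And>z. x + of_nat CARD('a) ^ l * of_padic_int z \<in> T"
      using T x unfolding open_padic_def by blast
    have "x + of_nat CARD('a) ^ (k + l) * of_padic_int z \<in> S \<inter> T" for z
      using k[of "of_nat CARD('a) ^ l * z"] l[of "of_nat CARD('a) ^ k * z"]
      by (simp add: of_padic_int_mult of_padic_int_power of_padic_int_of_nat power_add mult_ac)
    then show "\<exists>k. \<forall>z. x + of_nat CARD('a) ^ k * of_padic_int z \<in> S \<inter> T"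
      by blast
  qed
next
  fix K :: "'a padic set set"
  assume "\<forall>S\<in>K. open S"
  then show "open (\<Union>K)"
    unfolding open_padic_def by (meson Union_iff)
qed

end

definition GL :: "nat \<Rightarrow> 'a::semiring_1 mat set" where
  "GL n = {A \<in> carrier_mat n n. invertible_mat A}"

abbreviation GL_Zp :: "nat \<Rightarrow> 'p::prime_card padic mat set" where
  "GL_Zp n \<equiv> map_mat of_padic_int ` GL n"

abbreviation GL_Qp :: "nat \<Rightarrow> 'p::prime_card padic mat set" where
  "GL_Qp n \<equiv> GL n"

text \<open>
  The Borel \<open>\<sigma>\<close>-algebra of \<open>GL\<^sub>n(\<rat>\<^sub>p)\<close>, as the trace of the product \<open>\<sigma>\<close>-algebra on the matrix
  entries (which is the Borel one because \<open>\<rat>\<^sub>p\<close> is second countable).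
\<close>

definition borel_GL :: "nat \<Rightarrow> 'p::prime_card padic mat measure" where
  "borel_GL n = vimage_algebra (GL_Qp n)
     (\<lambda>A. \<lambda>ij\<in>{..<n} \<times> {..<n}. A $$ ij) (\<Pi>\<^sub>M ij\<in>{..<n} \<times> {..<n}. borel)"

definition GL_Zp_bi_invariant :: "nat \<Rightarrow> 'p::prime_card padic mat measure \<Rightarrow> bool" where
  "GL_Zp_bi_invariant n \<mu> \<longleftrightarrow>
     (\<forall>U \<in> GL_Zp n. distr \<mu> (borel_GL n) (\<lambda>X. U * X) = \<mu> \<and> distr \<mu> (borel_GL n) (\<lambda>X. X * U) = \<mu>)"

text \<open>
  Integer tuples \<open>(\<lambda>\<^sub>1,\<dots>,\<lambda>\<^sub>n)\<close> are lists of length \<open>n\<close>, so that \<open>\<lambda>\<^sub>i\<close> is \<open>ls ! (i - 1)\<close> and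
  the weight is \<open>sum_list\<close>.
\<close>

definition diag_p :: "nat \<Rightarrow> nat \<Rightarrow> int list \<Rightarrow> 'p::prime_card padic mat" where
  "diag_p n m ls = Matrix.mat n m (\<lambda>(i, j). if i = j then of_nat CARD('p) powi (ls ! i) else 0)"

text \<open>Meaningful for nonsingular \<open>A\<close> with \<open>dim_row A \<le> dim_col A\<close> only.\<close>

definition SN :: "'p::prime_card padic mat \<Rightarrow> int list" where
  "SN A = (THE ls. length ls = dim_row A \<and> sorted_wrt (\<ge>) ls \<and>
     (\<exists>U \<in> GL_Zp (dim_row A). \<exists>V \<in> GL_Zp (dim_col A).
        A = U * diag_p (dim_row A) (dim_col A) ls * V))"

text \<open>The submatrix \<open>A\<^sup>(\<^sup>i\<^sup>)\<close> of the last \<open>n - i + 1\<close> rows of an \<open>n \<times> n\<close> matrix; rows are indexed from 0.\<close>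

definition last_rows :: "nat \<Rightarrow> 'a mat \<Rightarrow> 'a mat" where
  "last_rows i A = submatrix A {i - 1..} UNIV"

end

theory Submission
  imports
    Defs
    "HOL-Number_Theory.Cong"
    "Jordan_Normal_Form.Determinant"
    "Jordan_Normal_Form.Column_Operations"
begin

text \<open>
  By the Iwasawa decomposition, \<open>A\<^sub>k = T\<^sub>k V\<^sub>k\<close> with \<open>T\<^sub>k\<close> upper triangular and \<open>V\<^sub>k \<in> GL\<^sub>n(\<int>\<^sub>p)\<close>, and
  \<open>|SN(A\<^sub>k\<^sup>(\<^sup>i\<^sup>))|\<close> is the valuation of the product of the diagonal entries of \<open>T\<^sub>k\<close> from the \<open>i\<close>-th on;
  hence \<open>v\<^sub>i(k) - v\<^sub>i(k - 1)\<close> is the valuation of the \<open>i\<close>-th diagonal entry.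
  Once the quantities in the splitting hypothesis are nonnegative, \<open>v(k)\<close> is non-increasing and
  \<open>p\<^bsup>v(k)\<^esup> T\<^sub>k\<^sub>+\<^sub>1 = U p\<^bsup>v(k+1)\<^esup>\<close> with \<open>U \<in> GL\<^sub>n(\<int>\<^sub>p)\<close> triangular, so that \<open>v\<close> itself follows
  the recursion defining \<open>\<lambda>\<close>.
  Finally \<open>SN(p\<^bsup>\<lambda>\<^esup> X)\<close> is a 1-Lipschitz function of \<open>\<lambda>\<close> in the maximum norm, so from then on the
  distance between \<open>\<lambda>(k)\<close> and \<open>v(k)\<close> does not grow.
\<close>

section \<open>The field of \<open>p\<close>-adic numbers and its valuation\<close>

lemma prime_card_int: "prime (int CARD('p::prime_card))"
  using prime_card[where 'a='p] by simp

lemma residue_of_nat: "residue (of_nat k :: 'p::prime_card padic_int) n = int k mod int CARD('p) ^ n"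
  by (induction k)
    (simp_all add: zero_padic_int.rep_eq one_padic_int.rep_eq plus_padic_int.rep_eq mod_simps)

text \<open>If the residue modulo p is nonzero, every \<open>residue x n\<close> is prime to
  \<open>p ^ n\<close> and invertible there. Inverses modulo \<open>p ^ n\<close> are unique, so
  those found for different n are coherent and assemble to an element of the inverse limit.\<close>

lemma padic_int_unitI:
  fixes x :: "'p::prime_card padic_int"
  assumes "residue x 1 \<noteq> 0"
  shows "x dvd 1"
proof -
  let ?p = "int CARD('p)"
  have cop: "coprime (residue x n) (?p ^ n)" for n
  proof (cases "n = 0")
    case False
    then have "residue x n mod ?p \<noteq> 0"
      using residue_mod[of 1 n x] assms by simp
    then have "coprime ?p (residue x n)"
      by (intro prime_imp_coprime[OF prime_card_int]) (simp add: dvd_eq_mod_eq_0)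
    then show ?thesis by (simp add: coprime_commute)
  qed simp
  have "\<exists>z. [residue x n * z = 1] (mod ?p ^ n)" for n
    using cong_solve_coprime_int[OF cop] .
  then obtain g where g: "\<And>n. [residue x n * g n = 1] (mod ?p ^ n)" by metis
  \<comment> \<open>The type admits only canonical residues, so the solutions chosen for each n are
    reduced first.\<close>
  define f where "f n = g n mod ?p ^ n" for n
  have f: "[residue x n * f n = 1] (mod ?p ^ n)" for n
    using g[of n] by (simp add: f_def cong_def mod_simps)
  have coh: "f (Suc n) mod ?p ^ n = f n" for n
  proof -
    have "[residue x (Suc n) * f (Suc n) = 1] (mod ?p ^ n)"
      using f[of "Suc n"] by (rule cong_dvd_modulus) (simp add: le_imp_power_dvd)
    moreover have "[residue x (Suc n) = residue x n] (mod ?p ^ n)"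
      using residue_Suc_mod[of x n] residue_mod[of n n x] by (simp add: cong_def)
    ultimately have "[residue x n * f (Suc n) = residue x n * f n] (mod ?p ^ n)"
      using f[of n] by (metis cong_scalar_right cong_sym cong_trans)
    then have "[f (Suc n) = f n] (mod ?p ^ n)"
      using cong_mult_lcancel cop by blast
    then show ?thesis by (simp add: cong_def f_def)
  qed
  define y :: "'p padic_int" where "y = Abs_padic_int f"
  have y: "residue y = f"
    unfolding y_def by (rule Abs_padic_int_inverse) (use coh in auto)
  have "x * y = 1"
    using f by (simp add: residue_inject [symmetric] fun_eq_iff times_padic_int.rep_eq
        one_padic_int.rep_eq y cong_def)
  then show ?thesis by (metis dvd_triv_left)
qed

text \<open>The exponent k is the last level at which the residue of x vanishes, so all later
  residues are divisible by \<open>p ^ k\<close>. Shifting the sequence by k places and dividing by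
  \<open>p ^ k\<close> gives the residues of the unit.\<close>

lemma padic_int_decomp:
  fixes x :: "'p::prime_card padic_int"
  assumes "x \<noteq> 0"
  obtains k u where "u dvd 1" "x = of_nat CARD('p) ^ k * u"
proof -
  let ?p = "int CARD('p)"
  obtain m where "residue x m \<noteq> 0"
    using assms unfolding residue_inject [symmetric] zero_padic_int.rep_eq fun_eq_iff by blast
  then have ex: "\<exists>m. residue x m \<noteq> 0" by blast
  define l where "l = (LEAST m. residue x m \<noteq> 0)"
  have l: "residue x l \<noteq> 0" unfolding l_def using ex by (rule LeastI_ex)
  have l': "residue x m = 0" if "m < l" for m
    using not_less_Least that unfolding l_def by blast
  \<comment> \<open>Residues modulo \<open>p ^ 0 = 1\<close> vanish, so the first nonzero level
    \<open>l\<close> is a successor.\<close>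
  have "residue x 0 = 0" using residue_mod[of 0 0 x] by simp
  then obtain k where k: "l = Suc k" using l by (cases l) auto
  have dvd: "?p ^ k dvd residue x (n + k)" for n
    using residue_mod[of k "n + k" x] l'[of k] k by (simp add: dvd_eq_mod_eq_0)
  define f where "f n = residue x (n + k) div ?p ^ k" for n
  have f: "residue x (n + k) = ?p ^ k * f n" for n
    unfolding f_def using dvd[of n] by simp
  have p0: "?p ^ k \<noteq> 0" by simp
  have coh: "f (Suc n) mod ?p ^ n = f n" for n
  proof -
    have "?p ^ k * (f (Suc n) mod ?p ^ n) = (?p ^ k * f (Suc n)) mod (?p ^ k * ?p ^ n)"
      by (rule mult_mod_right)
    also have "\<dots> = residue x (n + k)"
      using residue_Suc_mod[of x "n + k"] f[of "Suc n"] by (simp add: power_add mult.commute)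
    finally show ?thesis using f[of n] p0 by (metis mult_left_cancel)
  qed
  define u :: "'p padic_int" where "u = Abs_padic_int f"
  have u: "residue u = f"
    unfolding u_def by (rule Abs_padic_int_inverse) (use coh in auto)
  \<comment> \<open>Level 1 of u is level \<open>1 + k = l\<close> of x divided by
    \<open>p ^ k\<close>, hence nonzero by the choice of \<open>l\<close>.\<close>
  have "residue u 1 \<noteq> 0" using f[of 1] l k by (auto simp: u)
  then have "u dvd 1" by (rule padic_int_unitI)
  moreover have "x = of_nat CARD('p) ^ k * u"
  proof -
    have "residue x n = residue (of_nat CARD('p) ^ k * u) n" for n
    proof -
      have "residue x n = residue x (n + k) mod ?p ^ n"
        by (simp add: residue_mod)
      also have "\<dots> = (?p ^ k * f n) mod ?p ^ n" by (simp add: f)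
      also have "\<dots> = residue (of_nat CARD('p) ^ k * u) n"
        by (simp add: times_padic_int.rep_eq u residue_of_nat mod_simps flip: of_nat_power)
      finally show ?thesis .
    qed
    then show ?thesis by (simp add: residue_inject [symmetric] fun_eq_iff)
  qed
  ultimately show thesis by (rule that)
qed

section \<open>The subring of p-adic integers inside the field, and its units\<close>

interpretation of_padic_int_hom: inj_comm_ring_hom
  "of_padic_int :: 'p::prime_card padic_int \<Rightarrow> 'p padic"
proof
  show "x = 0" if "of_padic_int x = 0" for x :: "'p padic_int"
    using that by (simp add: fract_of_padic_inject [symmetric] fract_of_padic_of_padic_int
        zero_padic.rep_eq Zero_fract_def eq_fract)
qed (simp_all add: of_padic_int_0 of_padic_int_1 of_padic_int_add of_padic_int_mult)

definition Zp :: "'p::prime_card padic set" where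
  "Zp = range of_padic_int"

text \<open>The condition \<open>x \<noteq> 0\<close> is essential, because
  \<open>inverse 0 = 0\<close> lies in \<open>Zp\<close>.\<close>

definition Zp_units :: "'p::prime_card padic set" where
  "Zp_units = {x. x \<noteq> 0 \<and> x \<in> Zp \<and> inverse x \<in> Zp}"

abbreviation uniformizer :: "'p::prime_card padic" (\<open>\<pp>\<close>) where
  "\<pp> \<equiv> of_nat CARD('p)"

lemma Zp_0 [simp, intro]: "0 \<in> Zp"
  and Zp_1 [simp, intro]: "1 \<in> Zp"
  and Zp_add [intro]: "x \<in> Zp \<Longrightarrow> y \<in> Zp \<Longrightarrow> x + y \<in> Zp"
  and Zp_mult [intro]: "x \<in> Zp \<Longrightarrow> y \<in> Zp \<Longrightarrow> x * y \<in> Zp"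
  and Zp_uminus [intro]: "x \<in> Zp \<Longrightarrow> - x \<in> Zp"
  unfolding Zp_def
  by (auto simp flip: of_padic_int_hom.hom_zero of_padic_int_hom.hom_one of_padic_int_hom.hom_add
      of_padic_int_hom.hom_mult of_padic_int_hom.hom_uminus)

lemma Zp_sum [intro]: "(\<And>i. i \<in> I \<Longrightarrow> f i \<in> Zp) \<Longrightarrow> sum f I \<in> Zp"
  by (induction I rule: infinite_finite_induct) auto

lemma Zp_prod [intro]: "(\<And>i. i \<in> I \<Longrightarrow> f i \<in> Zp) \<Longrightarrow> prod f I \<in> Zp"
  by (induction I rule: infinite_finite_induct) auto

lemma Zp_of_nat [simp, intro]: "of_nat k \<in> Zp"
  by (induction k) auto

lemma of_padic_int_in_Zp [simp, intro]: "of_padic_int x \<in> Zp"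
  by (simp add: Zp_def)

lemma uniformizer_nonzero [simp]: "(\<pp> :: 'p::prime_card padic) \<noteq> 0"
proof -
  have "int CARD('p) \<noteq> 0" by simp
  \<comment> \<open>Modulo p itself the residue of p is 0; it first becomes nonzero modulo
    \<open>p ^ 2\<close>.\<close>
  moreover have "(int CARD('p) ^ 1) < int CARD('p) ^ 2"
    using prime_gt_1_int[OF prime_card_int[where 'p='p]] by (simp add: power2_eq_square)
  ultimately have "residue (of_nat CARD('p) :: 'p padic_int) 2 \<noteq> residue 0 2"
    by (simp add: residue_of_nat zero_padic_int.rep_eq)
  then have "(of_nat CARD('p) :: 'p padic_int) \<noteq> 0" by metis
  then show ?thesis by (metis of_padic_int_of_nat of_padic_int_hom.hom_0_iff)
qed

text \<open>An integral inverse y would give \<open>p * y = 1\<close>, which reads 0 = 1 modulo p.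
  Uniqueness of valuations and of singular numbers both rest on this fact.\<close>

lemma inverse_uniformizer_notin_Zp: "inverse (\<pp> :: 'p::prime_card padic) \<notin> Zp"
proof
  assume "inverse (\<pp> :: 'p padic) \<in> Zp"
  then obtain y :: "'p padic_int" where y: "inverse \<pp> = of_padic_int y" by (auto simp: Zp_def)
  have "of_padic_int (of_nat CARD('p) * y) = 1"
    by (simp add: of_padic_int_hom.hom_mult of_padic_int_of_nat flip: y)
  then have "of_nat CARD('p) * y = 1" by simp
  then have "residue (of_nat CARD('p) * y) 1 = residue (1 :: 'p padic_int) 1"
    by (rule arg_cong)
  then show False
    using prime_gt_1_int[OF prime_card_int[where 'p='p]]
    by (simp add: times_padic_int.rep_eq residue_of_nat one_padic_int.rep_eq)
qed

lemma Zp_units_1 [simp, intro]: "1 \<in> Zp_units"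
  by (simp add: Zp_units_def)

lemma Zp_units_mult [intro]: "x \<in> Zp_units \<Longrightarrow> y \<in> Zp_units \<Longrightarrow> x * y \<in> Zp_units"
  by (auto simp: Zp_units_def)

lemma Zp_units_inverse [intro]: "x \<in> Zp_units \<Longrightarrow> inverse x \<in> Zp_units"
  by (auto simp: Zp_units_def)

lemma Zp_units_uminus [intro]: "x \<in> Zp_units \<Longrightarrow> - x \<in> Zp_units"
  by (auto simp: Zp_units_def)

lemma of_padic_int_unit_iff: "of_padic_int x \<in> Zp_units \<longleftrightarrow> x dvd 1"
proof
  assume "x dvd 1"
  then obtain y where "1 = x * y" by (rule dvdE)
  then have xy: "of_padic_int x * of_padic_int y = 1"
    by (metis of_padic_int_hom.hom_mult of_padic_int_hom.hom_one)
  then have "inverse (of_padic_int x) = of_padic_int y"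
    by (rule inverse_unique)
  moreover have "of_padic_int x \<noteq> 0" using xy by (metis mult_zero_left zero_neq_one)
  ultimately show "of_padic_int x \<in> Zp_units" by (simp add: Zp_units_def)
next
  assume "of_padic_int x \<in> Zp_units"
  then obtain y where y: "inverse (of_padic_int x) = of_padic_int y" and "of_padic_int x \<noteq> 0"
    by (auto simp: Zp_units_def Zp_def)
  then have "of_padic_int (x * y) = 1"
    by (simp add: of_padic_int_hom.hom_mult flip: y)
  then have "x * y = 1" by simp
  then show "x dvd 1" by (metis dvd_triv_left)
qed

lemma uniformizer_powi_in_Zp_iff: "(\<pp> :: 'p::prime_card padic) powi e \<in> Zp \<longleftrightarrow> e \<ge> 0"
proof
  show "(\<pp> :: 'p padic) powi e \<in> Zp" if "e \<ge> 0"
    using that by (simp add: power_int_def flip: of_nat_power)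
next
  assume a: "(\<pp> :: 'p padic) powi e \<in> Zp"
  show "e \<ge> 0"
  proof (rule ccontr)
    assume "\<not> e \<ge> 0"
    \<comment> \<open>The exponent \<open>- 1 - e\<close> is nonnegative here, and it is chosen so
      that the product with \<open>\<pp> powi e\<close> is \<open>inverse \<pp>\<close>.\<close>
    then have "(\<pp> :: 'p padic) powi (- 1 - e) \<in> Zp"
      by (simp add: power_int_def flip: of_nat_power)
    then have "(\<pp> :: 'p padic) powi (- 1 - e) * \<pp> powi e \<in> Zp" using a by blast
    then have "inverse (\<pp> :: 'p padic) \<in> Zp"
      by (simp flip: power_int_add)
    then show False using inverse_uniformizer_notin_Zp by blast
  qed
qed

section \<open>The valuation, read off from the factorisation into a unit and a power of p\<close>

lemma padic_decomp:
  fixes x :: "'p::prime_card padic"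
  assumes "x \<noteq> 0"
  obtains e :: int and u where "u \<in> Zp_units" "x = u * \<pp> powi e"
proof -
  have int: "\<exists>k::nat. \<exists>u\<in>Zp_units. (of_padic_int y :: 'p padic) = u * \<pp> ^ k" if "y \<noteq> 0" for y
  proof -
    obtain k u where "u dvd 1" "y = of_nat CARD('p) ^ k * u"
      using padic_int_decomp[OF \<open>y \<noteq> 0\<close>] .
    then show ?thesis
      by (intro exI[of _ k] bexI[of _ "of_padic_int u"])
        (simp_all add: of_padic_int_unit_iff of_padic_int_hom.hom_mult of_padic_int_power
          of_padic_int_of_nat mult.commute)
  qed
  \<comment> \<open>Writing x as a fraction, its exponent is the difference of those of numerator
    and denominator.\<close>
  obtain a b where ab: "fract_of_padic x = Fract a b" "b \<noteq> 0"
    by (cases "fract_of_padic x")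
  then have x: "x * of_padic_int b = of_padic_int a"
    by (simp add: fract_of_padic_inject [symmetric] fract_of_padic_of_padic_int
        times_padic.rep_eq eq_fract)
  have b0: "of_padic_int b \<noteq> 0" using ab by simp
  then have "a \<noteq> 0" using x assms by auto
  obtain k u where u: "u \<in> Zp_units" "(of_padic_int a :: 'p padic) = u * \<pp> ^ k"
    using int[OF \<open>a \<noteq> 0\<close>] by blast
  obtain l w where w: "w \<in> Zp_units" "(of_padic_int b :: 'p padic) = w * \<pp> ^ l"
    using int[OF \<open>b \<noteq> 0\<close>] by blast
  have w0: "w \<noteq> 0" using w by (simp add: Zp_units_def)
  have "x = of_padic_int a / of_padic_int b" using x b0 by (simp add: field_simps)
  also have "\<dots> = (u * inverse w) * \<pp> powi (int k - int l)"
    using w0 by (simp add: u w power_int_diff field_simps)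
  finally show thesis using u w by (intro that) auto
qed

text \<open>No exponent qualifies for x = 0, so \<open>pval 0\<close> is an unspecified integer and
  zero is treated separately below.\<close>

definition pval :: "'p::prime_card padic \<Rightarrow> int" where
  "pval x = (THE e. x / \<pp> powi e \<in> Zp_units)"

lemma pval_unit_powi [simp]:
  assumes "u \<in> Zp_units"
  shows "pval (u * \<pp> powi e :: 'p::prime_card padic) = e"
  unfolding pval_def
proof (rule the_equality)
  show "u * \<pp> powi e / \<pp> powi e \<in> Zp_units" using assms by simp
next
  fix f assume f: "u * \<pp> powi e / (\<pp> :: 'p padic) powi f \<in> Zp_units"
  then have "inverse u * (u * \<pp> powi e / (\<pp> :: 'p padic) powi f) \<in> Zp_units"
    using assms by blast
  moreover have "u \<noteq> 0" using assms by (simp add: Zp_units_def)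
  ultimately have "(\<pp> :: 'p padic) powi (e - f) \<in> Zp_units"
    by (simp add: power_int_diff field_simps)
  \<comment> \<open>A power of p that is a unit is integral together with its inverse, which forces
    the exponent 0.\<close>
  then have "(\<pp> :: 'p padic) powi (e - f) \<in> Zp" "(\<pp> :: 'p padic) powi (f - e) \<in> Zp"
    by (auto simp: Zp_units_def power_int_minus[symmetric])
  then show "f = e" unfolding uniformizer_powi_in_Zp_iff by simp
qed

lemma pval_powi [simp]: "pval (\<pp> powi e :: 'p::prime_card padic) = e"
  using pval_unit_powi[of 1 e] by simp

lemma pval_decomp:
  fixes x :: "'p::prime_card padic"
  assumes "x \<noteq> 0"
  obtains u where "u \<in> Zp_units" "x = u * \<pp> powi pval x"
  using padic_decomp[OF assms] pval_unit_powi by metis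

lemma pval_unit [simp]: "u \<in> Zp_units \<Longrightarrow> pval u = 0"
  using pval_unit_powi[of u 0] by simp

lemma pval_mult:
  assumes "x \<noteq> 0" "y \<noteq> 0"
  shows "pval (x * y :: 'p::prime_card padic) = pval x + pval y"
proof -
  obtain u where u: "u \<in> Zp_units" "x = u * \<pp> powi pval x" using pval_decomp[OF assms(1)] .
  obtain w where w: "w \<in> Zp_units" "y = w * \<pp> powi pval y" using pval_decomp[OF assms(2)] .
  have "x * y = (u * w) * \<pp> powi (pval x + pval y)"
    by (subst u(2), subst w(2)) (simp add: power_int_add)
  then show ?thesis using u w by (metis Zp_units_mult pval_unit_powi)
qed

lemma pval_prod:
  assumes "\<And>i. i \<in> I \<Longrightarrow> f i \<noteq> 0"
  shows "pval (prod f I :: 'p::prime_card padic) = (\<Sum>i\<in>I. pval (f i))"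
  using assms by (induction I rule: infinite_finite_induct) (simp_all add: pval_mult)

lemma pval_inverse:
  assumes "x \<noteq> 0"
  shows "pval (inverse x :: 'p::prime_card padic) = - pval x"
  using pval_mult[of x "inverse x"] assms by simp

lemma Zp_iff_pval: "x \<noteq> 0 \<Longrightarrow> x \<in> Zp \<longleftrightarrow> pval x \<ge> 0"
proof -
  assume "x \<noteq> 0"
  then obtain u where u: "u \<in> Zp_units" "x = u * \<pp> powi pval x" by (rule pval_decomp)
  then have "u \<in> Zp" "inverse u \<in> Zp" "u \<noteq> 0" by (auto simp: Zp_units_def)
  moreover from this have "inverse u * x = \<pp> powi pval x"
    by (subst u(2)) simp
  ultimately have "x \<in> Zp \<longleftrightarrow> \<pp> powi pval x \<in> (Zp :: 'a padic set)"
    using Zp_mult[of "inverse u" x] Zp_mult[of u "\<pp> powi pval x"]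
    by (auto simp flip: u(2))
  then show ?thesis by (simp add: uniformizer_powi_in_Zp_iff)
qed

lemma Zp_units_iff_pval: "x \<noteq> 0 \<Longrightarrow> x \<in> Zp_units \<longleftrightarrow> pval x = 0"
  by (auto simp: Zp_units_def Zp_iff_pval pval_inverse simp del: pval_unit)

lemma divide_in_Zp_iff: "x \<noteq> 0 \<Longrightarrow> y \<noteq> 0 \<Longrightarrow> x / y \<in> Zp \<longleftrightarrow> pval y \<le> pval x"
  by (simp add: Zp_iff_pval divide_inverse pval_mult pval_inverse)

section \<open>Integral matrices and \<open>GL\<^sub>n(\<int>\<^sub>p)\<close>\<close>

definition Zp_mat :: "nat \<Rightarrow> nat \<Rightarrow> 'p::prime_card padic mat set" where
  "Zp_mat n m = {A \<in> carrier_mat n m. \<forall>i<n. \<forall>j<m. A $$ (i, j) \<in> Zp}"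

lemma Zp_mat_carrier: "A \<in> Zp_mat n m \<Longrightarrow> A \<in> carrier_mat n m"
  by (simp add: Zp_mat_def)

lemma Zp_mat_index: "A \<in> Zp_mat n m \<Longrightarrow> i < n \<Longrightarrow> j < m \<Longrightarrow> A $$ (i, j) \<in> Zp"
  by (simp add: Zp_mat_def)

lemma Zp_mat_mult:
  assumes "A \<in> Zp_mat n k" "B \<in> Zp_mat k m"
  shows "A * B \<in> Zp_mat n m"
  using assms by (auto simp: Zp_mat_def scalar_prod_def intro!: Zp_sum Zp_mult)

lemma signof_in_Zp: "signof \<pi> \<in> Zp"
  by (auto simp: sign_def)

lemma det_in_Zp: "A \<in> Zp_mat n n \<Longrightarrow> det A \<in> Zp"
  unfolding Zp_mat_def
  by (auto simp: det_def' intro!: Zp_sum Zp_mult Zp_prod signof_in_Zp)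

lemma GL_inverseE:
  fixes A :: "'a::comm_ring_1 mat"
  assumes "A \<in> GL n"
  obtains B where "A \<in> carrier_mat n n" "B \<in> GL n" "B \<in> carrier_mat n n"
    "A * B = 1\<^sub>m n" "B * A = 1\<^sub>m n"
proof -
  have A: "A \<in> carrier_mat n n" using assms by (simp add: GL_def)
  obtain B where B: "A * B = 1\<^sub>m n" "B * A = 1\<^sub>m (dim_row B)"
    using assms by (auto simp: GL_def invertible_mat_def inverts_mat_def)
  have "dim_col B = n" using B(1) by (metis index_mult_mat(3) index_one_mat(3))
  moreover have "dim_row B = n"
    using B(2) A by (metis carrier_matD(2) index_mult_mat(3) index_one_mat(3))
  ultimately have Bn: "B \<in> carrier_mat n n" by auto
  then have BA: "B * A = 1\<^sub>m n" using B(2) by simp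
  have "B \<in> GL n"
    using A B(1) BA Bn unfolding GL_def invertible_mat_def inverts_mat_def by auto
  then show thesis using that A Bn B(1) BA by blast
qed

lemma det_dvd_1_if_GL:
  fixes A :: "'a::comm_ring_1 mat"
  assumes "A \<in> GL n"
  shows "det A dvd 1"
proof -
  obtain B where B: "A \<in> carrier_mat n n" "B \<in> carrier_mat n n" "A * B = 1\<^sub>m n"
    using GL_inverseE[OF assms] by metis
  have "det A * det B = 1" using det_mult[OF B(1,2)] B(3) by simp
  then show ?thesis by (metis dvd_triv_left)
qed

text \<open>Cramer's rule: over \<open>\<int>\<^sub>p\<close> the adjugate, scaled by the inverse of
  the determinant, is an inverse. Membership can thus be tested on entries and determinant
  alone.\<close>

lemma GL_Zp_iff: "U \<in> GL_Zp n \<longleftrightarrow> U \<in> Zp_mat n n \<and> det U \<in> Zp_units"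
proof
  assume "U \<in> GL_Zp n"
  then obtain B where B: "B \<in> GL n" and U: "U = map_mat of_padic_int B" by auto
  then show "U \<in> Zp_mat n n \<and> det U \<in> Zp_units"
    using det_dvd_1_if_GL[OF B] by (auto simp: GL_def Zp_mat_def of_padic_int_unit_iff)
next
  assume U: "U \<in> Zp_mat n n \<and> det U \<in> Zp_units"
  define B where "B = Matrix.mat n n (\<lambda>ij. inv_into UNIV of_padic_int (U $$ ij))"
  have B: "B \<in> carrier_mat n n" by (simp add: B_def)
  have UB: "U = map_mat of_padic_int B"
  proof (rule eq_matI)
    fix i j assume "i < dim_row (map_mat of_padic_int B)" "j < dim_col (map_mat of_padic_int B)"
    then have "i < n" "j < n" "U $$ (i, j) \<in> range of_padic_int"
      using U by (auto simp: B_def Zp_mat_def Zp_def)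
    then show "U $$ (i, j) = map_mat of_padic_int B $$ (i, j)"
      by (simp add: B_def f_inv_into_f)
  qed (use U in \<open>auto simp: B_def Zp_mat_def\<close>)
  then have "det B dvd 1" using U by (simp add: of_padic_int_unit_iff)
  then obtain c where c: "1 = det B * c" by (rule dvdE)
  have "B * (c \<cdot>\<^sub>m adj_mat B) = 1\<^sub>m n" "c \<cdot>\<^sub>m adj_mat B * B = 1\<^sub>m n"
    using adj_mat[OF B] B c by (auto simp: mult_smult_distrib mult_smult_assoc_mat[OF _ B] mult.commute)
  then have "invertible_mat B"
    using B adj_mat(1)[OF B] unfolding invertible_mat_def inverts_mat_def
    by (intro conjI exI[of _ "c \<cdot>\<^sub>m adj_mat B"]) auto
  then show "U \<in> GL_Zp n" using B UB by (auto simp: GL_def)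
qed

lemma GL_ZpD:
  assumes "U \<in> GL_Zp n"
  shows "U \<in> Zp_mat n n" "U \<in> carrier_mat n n" "det U \<in> Zp_units"
  using assms unfolding GL_Zp_iff by (auto simp: Zp_mat_carrier)

lemma one_in_GL_Zp: "1\<^sub>m n \<in> GL_Zp n"
  unfolding GL_Zp_iff by (simp add: Zp_mat_def)

lemma GL_Zp_mult: "U \<in> GL_Zp n \<Longrightarrow> V \<in> GL_Zp n \<Longrightarrow> U * V \<in> GL_Zp n"
  unfolding GL_Zp_iff
  by (auto simp: det_mult[OF Zp_mat_carrier Zp_mat_carrier] intro: Zp_mat_mult)

lemma GL_Zp_inverse:
  assumes "U \<in> GL_Zp n"
  obtains W where "W \<in> GL_Zp n" "U * W = 1\<^sub>m n" "W * U = 1\<^sub>m n"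
proof -
  from assms obtain B where "B \<in> GL n" and U: "U = map_mat of_padic_int B" by auto
  then obtain C where C: "B \<in> carrier_mat n n" "C \<in> GL n" "C \<in> carrier_mat n n"
    "B * C = 1\<^sub>m n" "C * B = 1\<^sub>m n"
    using GL_inverseE by metis
  have "U * map_mat of_padic_int C = 1\<^sub>m n" "map_mat of_padic_int C * U = 1\<^sub>m n"
    using C by (simp_all add: U of_padic_int_hom.mat_hom_one
        flip: of_padic_int_hom.mat_hom_mult[OF C(1,3)] of_padic_int_hom.mat_hom_mult[OF C(3,1)])
  then show thesis using C(2) by (intro that) auto
qed

section \<open>Row swaps and block matrices over the p-adic integers\<close>

lemma minus_one_in_Zp_units: "- 1 \<in> Zp_units"
  by (intro Zp_units_uminus Zp_units_1)

lemma swaprows_mat_in_GL_Zp: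
  assumes "k < n" "l < n"
  shows "swaprows_mat n k l \<in> GL_Zp n"
proof (cases "k = l")
  case True
  then have "swaprows_mat n k l = 1\<^sub>m n" by (intro eq_matI) auto
  then show ?thesis using one_in_GL_Zp by metis
next
  case False
  then show ?thesis
    unfolding GL_Zp_iff
    by (auto simp: Zp_mat_def det_swaprows_mat[OF assms False] minus_one_in_Zp_units)
qed

lemma four_block_lower_in_GL_Zp:
  assumes "V \<in> GL_Zp n" "r \<in> Zp_mat 1 n" "u \<in> Zp_units"
  shows "four_block_mat V (0\<^sub>m n 1) r (Matrix.mat 1 1 (\<lambda>_. u)) \<in> GL_Zp (Suc n)"
proof -
  have V: "V \<in> carrier_mat n n" "V \<in> Zp_mat n n" "det V \<in> Zp_units" using GL_ZpD[OF assms(1)] by auto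
  have u: "u \<in> Zp" using assms by (simp add: Zp_units_def)
  have "det (four_block_mat V (0\<^sub>m n 1) r (Matrix.mat 1 1 (\<lambda>_. u))) = det V * u"
    using V assms(2)
    by (subst det_four_block_mat_upper_right_zero_col[of _ n]) (auto simp: Zp_mat_def det_single)
  then show ?thesis
    using V u assms(2,3) unfolding GL_Zp_iff by (auto simp: Zp_mat_def)
qed

lemma four_block_upper_in_GL_Zp:
  assumes "c \<in> Zp_mat n 1"
  shows "four_block_mat (1\<^sub>m n) c (0\<^sub>m 1 n) (1\<^sub>m 1) \<in> GL_Zp (Suc n)"
proof -
  have "det (four_block_mat (1\<^sub>m n) c (0\<^sub>m 1 n) (1\<^sub>m 1)) = 1"
    using assms by (subst det_four_block_mat_lower_left_zero[of _ n _ 1]) (auto simp: Zp_mat_def)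
  then show ?thesis
    using assms unfolding GL_Zp_iff by (auto simp: Zp_mat_def)
qed

text \<open>Otherwise W modulo p would be an invertible matrix over a field with a zero block of a
  size forbidden by the Frobenius-Koenig theorem. By pigeonhole every permutation sends some row of
  R into S, so each term of the Leibniz formula would be divisible by p, and with them the
  determinant, which is a unit.\<close>

lemma GL_Zp_no_large_zero_block:
  fixes W :: "'p::prime_card padic mat"
  assumes W: "W \<in> GL_Zp m" and R: "R \<subseteq> {..<m}" and S: "S \<subseteq> {..<m}" and card: "card R + card S > m"
  shows "\<exists>r\<in>R. \<exists>s\<in>S. W $$ (r, s) / \<pp> \<notin> Zp"
proof (rule ccontr)
  assume "\<not> ?thesis"
  then have block: "W $$ (r, s) / \<pp> \<in> Zp" if "r \<in> R" "s \<in> S" for r s using that by blast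
  note W' = GL_ZpD[OF W]
  have "signof \<pi> * (\<Prod>i = 0..<m. W $$ (i, \<pi> i)) / \<pp> \<in> Zp" if \<pi>: "\<pi> permutes {0..<m}" for \<pi>
  proof -
    have "\<exists>r\<in>R. \<pi> r \<in> S"
    proof (rule ccontr)
      assume "\<not> ?thesis"
      then have "\<pi> ` R \<subseteq> {..<m} - S"
        using R permutes_in_image[OF \<pi>] by auto
      then have "card (\<pi> ` R) \<le> card ({..<m} - S)" by (intro card_mono) auto
      moreover have "card (\<pi> ` R) = card R"
        using permutes_inj[OF \<pi>] by (intro card_image) (auto intro: inj_on_subset)
      moreover have "card ({..<m} - S) = m - card S"
        using S finite_subset[OF S] by (simp add: card_Diff_subset)
      moreover have "card S \<le> m" using card_mono[OF _ S] by simp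
      ultimately show False using card by simp
    qed
    then obtain r where r: "r \<in> R" "\<pi> r \<in> S" by blast
    have rm: "r \<in> {0..<m}" using r R by auto
    have prod: "(\<Prod>i = 0..<m. W $$ (i, \<pi> i)) = W $$ (r, \<pi> r) * (\<Prod>i \<in> {0..<m} - {r}. W $$ (i, \<pi> i))"
      using rm by (intro prod.remove) auto
    moreover have "(\<Prod>i \<in> {0..<m} - {r}. W $$ (i, \<pi> i)) \<in> Zp"
      using permutes_in_image[OF \<pi>] by (intro Zp_prod Zp_mat_index[OF W'(1)]) auto
    moreover have "(signof \<pi> :: 'p padic) \<in> Zp" by (rule signof_in_Zp)
    ultimately have "signof \<pi> * (\<Prod>i \<in> {0..<m} - {r}. W $$ (i, \<pi> i)) * (W $$ (r, \<pi> r) / \<pp>) \<in> Zp"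
      using block[OF r] by (intro Zp_mult)
    then show ?thesis
      using prod by (simp add: mult_ac)
  qed
  then have "det W / \<pp> \<in> Zp"
    unfolding det_def'[OF W'(2)] sum_divide_distrib by (intro Zp_sum) auto
  then have "inverse (det W) * (det W / \<pp>) \<in> Zp"
    using W'(3) by (intro Zp_mult) (auto simp: Zp_units_def)
  moreover have "inverse (det W) * (det W / \<pp>) = inverse \<pp>"
    using W'(3) by (simp add: Zp_units_def field_simps)
  ultimately have "inverse (\<pp> :: 'p padic) \<in> Zp" by simp
  then show False using inverse_uniformizer_notin_Zp by blast
qed

section \<open>Diagonal matrices of powers of p, and comparison of their exponents\<close>

lemma diag_p_carrier [simp]: "diag_p n m ls \<in> carrier_mat n m"
  by (simp add: diag_p_def)

lemma diag_p_mult_index: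
  assumes "W \<in> carrier_mat m k" "n \<le> m" "i < n" "j < k"
  shows "(diag_p n m ls * W) $$ (i, j) = \<pp> powi (ls ! i) * W $$ (i, j)"
proof -
  have "(diag_p n m ls * W) $$ (i, j)
      = (\<Sum>l\<in>{0..<m}. (if l = i then \<pp> powi (ls ! i) * W $$ (l, j) else 0))"
    using assms by (auto simp: diag_p_def scalar_prod_def simp del: sum.delta sum.delta' intro!: sum.cong)
  then show ?thesis using assms by (simp add: sum.delta)
qed

lemma mult_diag_p_index:
  assumes "W \<in> carrier_mat k n" "i < k" "j < m"
  shows "(W * diag_p n m ls) $$ (i, j) = (if j < n then W $$ (i, j) * \<pp> powi (ls ! j) else 0)"
proof -
  have "(W * diag_p n m ls) $$ (i, j)
      = (\<Sum>l\<in>{0..<n}. (if l = j then W $$ (i, l) * \<pp> powi (ls ! j) else 0))"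
    using assms by (auto simp: diag_p_def scalar_prod_def simp del: sum.delta sum.delta' intro!: sum.cong)
  then show ?thesis using assms by (simp add: sum.delta)
qed

lemma det_diag_p: "length ls = n \<Longrightarrow> det (diag_p n n ls) = \<pp> powi sum_list ls"
proof -
  assume n: "length ls = n"
  have "det (diag_p n n ls) = prod_list (diag_mat (diag_p n n ls))"
    by (rule det_upper_triangular[of _ n]) (auto simp: diag_p_def upper_triangular_def)
  also have "diag_mat (diag_p n n ls) = map (\<lambda>i. \<pp> powi i) ls"
    using n by (intro nth_equalityI) (auto simp: diag_mat_def diag_p_def)
  also have "prod_list (map (\<lambda>i. (\<pp> :: 'a padic) powi i) ls) = \<pp> powi sum_list ls"
    by (induction ls) (simp_all add: power_int_add)
  finally show ?thesis .
qed

text \<open>Moving the invertible factors together gives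
  \<open>diag_p n m b * W = F * diag_p n m a\<close> with W invertible and F integral. If
  \<open>a ! i > b ! i\<close>, then in the rows from i on W is divisible by p in the columns up to
  i and zero in the columns from n on: a block too large for an invertible matrix.\<close>

lemma SN_comparison:
  fixes E :: "'p::prime_card padic mat"
  assumes nm: "n \<le> m" and len: "length a = n" "length b = n"
    and sorted: "sorted_wrt (\<ge>) a" "sorted_wrt (\<ge>) b"
    and U: "U \<in> GL_Zp n" and V: "V \<in> GL_Zp m" and U': "U' \<in> GL_Zp n" and V': "V' \<in> GL_Zp m"
    and E: "E \<in> Zp_mat n n"
    and eq: "U' * diag_p n m b * V' = E * (U * diag_p n m a * V)"
    and i: "i < n"
  shows "a ! i \<le> b ! i"
proof (rule ccontr)
  assume less: "\<not> a ! i \<le> b ! i"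
  obtain X where X: "X \<in> GL_Zp n" "X * U' = 1\<^sub>m n" using GL_Zp_inverse[OF U'] .
  obtain Y where Y: "Y \<in> GL_Zp m" "V * Y = 1\<^sub>m m" using GL_Zp_inverse[OF V] .
  define W where "W = V' * Y"
  define F where "F = X * E * U"
  have W: "W \<in> GL_Zp m" unfolding W_def by (rule GL_Zp_mult) (use V' Y in auto)
  have F: "F \<in> Zp_mat n n" unfolding F_def
    by (intro Zp_mat_mult[of _ n n]) (use X E U GL_ZpD in auto)
  note carr = GL_ZpD(2)[OF U] GL_ZpD(2)[OF V] GL_ZpD(2)[OF U'] GL_ZpD(2)[OF V'] GL_ZpD(2)[OF X(1)]
    GL_ZpD(2)[OF Y(1)] Zp_mat_carrier[OF E] GL_ZpD(2)[OF W] Zp_mat_carrier[OF F]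
  have "diag_p n m b * W = F * diag_p n m a"
  proof -
    have "diag_p n m b * W = (X * U') * diag_p n m b * (V' * Y)"
      using carr by (simp add: X W_def left_mult_one_mat[of _ n m])
    also have "\<dots> = X * (U' * diag_p n m b * V') * Y"
      using carr by (simp add: assoc_mult_mat[of _ n n _ n _ m] assoc_mult_mat[of _ n n _ m _ m]
          assoc_mult_mat[of _ n m _ m _ m] mult_carrier_mat[of _ n n _ m] mult_carrier_mat[of _ n m _ m])
    also have "\<dots> = X * E * U * diag_p n m a * (V * Y)"
      unfolding eq using carr
      by (simp add: assoc_mult_mat[of _ n n _ n _ m] assoc_mult_mat[of _ n n _ m _ m]
          assoc_mult_mat[of _ n n _ n _ n] assoc_mult_mat[of _ n m _ m _ m]
          mult_carrier_mat[of _ n n _ m] mult_carrier_mat[of _ n m _ m])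
    also have "\<dots> = F * diag_p n m a"
      unfolding Y(2) F_def [symmetric]
      using carr by (intro right_mult_one_mat[of _ n m] mult_carrier_mat[of _ n n]) auto
    finally show ?thesis .
  qed
  then have ent: "\<pp> powi (b ! r) * W $$ (r, s) = (if s < n then F $$ (r, s) * \<pp> powi (a ! s) else 0)"
    if "r < n" "s < m" for r s
    using diag_p_mult_index[OF carr(8) nm that, of b] mult_diag_p_index[OF carr(9) that, of a] by simp
  have mono: "a ! i \<le> a ! s" if "s \<le> i" for s
    using sorted(1) that i len by (cases "s = i") (auto simp: sorted_wrt_iff_nth_less)
  have monob: "b ! r \<le> b ! i" if "i \<le> r" "r < n" for r
    using sorted(2) that i len by (cases "r = i") (auto simp: sorted_wrt_iff_nth_less)
  \<comment> \<open>The block has \<open>n - i\<close> rows and \<open>(i + 1) + (m - n)\<close>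
    columns, which add up to \<open>m + 1\<close>.\<close>
  have "\<exists>r\<in>{i..<n}. \<exists>s\<in>{..i} \<union> {n..<m}. W $$ (r, s) / \<pp> \<notin> Zp"
  proof (rule GL_Zp_no_large_zero_block[OF W])
    have "card ({..i} \<union> {n..<m}) = card {..i} + card {n..<m}"
      using i by (intro card_Un_disjoint) auto
    then show "m < card {i..<n} + card ({..i} \<union> {n..<m})" using i nm by simp
  qed (use i nm in auto)
  then obtain r s where "r \<in> {i..<n}" "s \<in> {..i} \<union> {n..<m}" "W $$ (r, s) / \<pp> \<notin> Zp"
    by blast
  then have rs: "i \<le> r" "r < n" "s \<le> i \<or> n \<le> s \<and> s < m" "W $$ (r, s) / \<pp> \<notin> Zp"
    by auto
  have sm: "s < m" using rs i nm by auto
  show False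
  proof (cases "s < n")
    case False
    then have "W $$ (r, s) = 0" using ent[OF rs(2) sm] by simp
    then show False using rs by simp
  next
    case True
    then have "W $$ (r, s) = F $$ (r, s) * \<pp> powi (a ! s - b ! r)"
      using ent[OF rs(2) sm] by (simp add: power_int_diff field_simps)
    then have "W $$ (r, s) / \<pp> = F $$ (r, s) * \<pp> powi (a ! s - b ! r - 1)"
      by (simp add: power_int_diff)
    \<comment> \<open>By monotonicity \<open>a ! s \<ge> a ! i > b ! i \<ge> b ! r\<close>; since
      these are integers, one factor p can be split off.\<close>
    moreover have "a ! s - b ! r - 1 \<ge> 0"
      using mono[of s] monob[of r] rs True less by auto
    ultimately have "W $$ (r, s) / \<pp> \<in> Zp"
      using Zp_mat_index[OF F rs(2) True] by (auto simp: uniformizer_powi_in_Zp_iff)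
    then show False using rs by simp
  qed
qed

section \<open>Singular numbers and the Smith normal form\<close>

text \<open>The condition under the description operator in \<open>SN\<close>, isolated so that
  existence and uniqueness can be proved separately.\<close>

definition is_SN :: "'p::prime_card padic mat \<Rightarrow> int list \<Rightarrow> bool" where
  "is_SN A ls \<longleftrightarrow> length ls = dim_row A \<and> sorted_wrt (\<ge>) ls \<and>
     (\<exists>U \<in> GL_Zp (dim_row A). \<exists>V \<in> GL_Zp (dim_col A).
        A = U * diag_p (dim_row A) (dim_col A) ls * V)"

lemma is_SNI:
  assumes "length ls = n" "sorted_wrt (\<ge>) ls" "U \<in> GL_Zp n" "V \<in> GL_Zp m"
    "A = U * diag_p n m ls * V"
  shows "is_SN A ls"
proof -
  have "dim_row A = n" "dim_col A = m"
    using assms GL_ZpD(2)[OF assms(3)] GL_ZpD(2)[OF assms(4)] by auto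
  then show ?thesis using assms unfolding is_SN_def by blast
qed

lemma is_SNE:
  assumes "is_SN A ls" "A \<in> carrier_mat n m"
  obtains U V where "length ls = n" "sorted_wrt (\<ge>) ls" "U \<in> GL_Zp n" "V \<in> GL_Zp m"
    "A = U * diag_p n m ls * V"
proof -
  have "dim_row A = n" "dim_col A = m" using assms(2) by auto
  with assms(1) show thesis unfolding is_SN_def using that by blast
qed

lemma is_SN_mono:
  assumes "is_SN A a" "is_SN B b" "A \<in> carrier_mat n m" "n \<le> m"
    and "E \<in> Zp_mat n n" "B = E * A" "i < n"
  shows "a ! i \<le> b ! i"
proof -
  have B: "B \<in> carrier_mat n m" using assms Zp_mat_carrier[OF assms(5)] by auto
  obtain U V where U: "length a = n" "sorted_wrt (\<ge>) a" "U \<in> GL_Zp n" "V \<in> GL_Zp m"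
    "A = U * diag_p n m a * V" using is_SNE[OF assms(1,3)] .
  obtain U' V' where U': "length b = n" "sorted_wrt (\<ge>) b" "U' \<in> GL_Zp n" "V' \<in> GL_Zp m"
    "B = U' * diag_p n m b * V'" using is_SNE[OF assms(2) B] .
  show ?thesis
    by (rule SN_comparison[OF assms(4) U(1) U'(1) U(2) U'(2) U(3,4) U'(3,4) assms(5) _ assms(7)])
      (use U(5) U'(5) assms(6) in simp)
qed

text \<open>Monotonicity with the identity as integral factor compares the two lists entrywise in
  both directions.\<close>

lemma is_SN_unique:
  assumes "is_SN A a" "is_SN A b" "dim_row A \<le> dim_col A"
  shows "a = b"
proof (rule nth_equalityI)
  have A: "A \<in> carrier_mat (dim_row A) (dim_col A)" by simp
  have one: "1\<^sub>m (dim_row A) \<in> Zp_mat (dim_row A) (dim_row A)" "A = 1\<^sub>m (dim_row A) * A"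
    by (simp_all add: Zp_mat_def)
  show "length a = length b" using assms by (simp add: is_SN_def)
  fix i assume "i < length a"
  then have "i < dim_row A" using assms by (simp add: is_SN_def)
  then show "a ! i = b ! i"
    using is_SN_mono[OF assms(1,2) A assms(3) one, of i] is_SN_mono[OF assms(2,1) A assms(3) one, of i]
    by simp
qed

lemma SN_eqI:
  assumes "is_SN A ls" "dim_row A \<le> dim_col A"
  shows "SN A = ls"
proof -
  have "SN A = (THE ls. is_SN A ls)" unfolding SN_def is_SN_def ..
  also have "\<dots> = ls" using assms is_SN_unique by blast
  finally show ?thesis .
qed

section \<open>Elimination with a pivot of minimal valuation: Iwasawa decomposition and Smith normal
  form\<close>

lemma row_nonzero_if_det_nonzero:
  fixes A :: "'a::idom mat"
  assumes "A \<in> carrier_mat n n" "det A \<noteq> 0" "i < n"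
  obtains j where "j < n" "A $$ (i, j) \<noteq> 0"
proof -
  have "\<exists>j<n. A $$ (i, j) \<noteq> 0"
  proof (rule ccontr)
    assume "\<not> ?thesis"
    \<comment> \<open>A zero row makes this diagonal entry vanish, although it equals
      \<open>det A\<close>.\<close>
    then have "(A * adj_mat A) $$ (i, i) = 0"
      using assms adj_mat(1)[OF assms(1)] by (auto simp: scalar_prod_def)
    then show False using adj_mat(2)[OF assms(1)] assms by simp
  qed
  then show thesis using that by blast
qed

text \<open>Supplies the pivot: an entry of least valuation divides all the others over
  \<open>\<int>\<^sub>p\<close>, so elimination with it uses integral multipliers.\<close>

lemma ex_min_pval:
  fixes f :: "'a \<Rightarrow> 'p::prime_card padic"
  assumes "finite I" "i \<in> I" "f i \<noteq> 0"
  obtains k where "k \<in> I" "f k \<noteq> 0" "\<And>l. l \<in> I \<Longrightarrow> f l / f k \<in> Zp"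
proof -
  let ?J = "{i \<in> I. f i \<noteq> 0}"
  have J: "finite ?J" "?J \<noteq> {}" using assms by auto
  define k where "k = arg_min_on (pval \<circ> f) ?J"
  have k: "k \<in> ?J" unfolding k_def using J by (rule arg_min_if_finite)
  have "f l / f k \<in> Zp" if "l \<in> I" for l
  proof (cases "f l = 0")
    case False
    then have "pval (f k) \<le> pval (f l)"
      using arg_min_least[OF J, of l "pval \<circ> f"] that by (simp add: k_def)
    then show ?thesis using False k by (simp add: divide_in_Zp_iff)
  qed simp
  then show thesis using k that by blast
qed

text \<open>One elimination step with the corner entry as pivot; the upper left block that remains
  is the Schur complement of the pivot.\<close>

lemma clear_last_row:
  fixes A :: "'p::prime_card padic mat"
  assumes A: "A \<in> carrier_mat (Suc n) (Suc n)" and a: "A $$ (n, n) \<noteq> 0"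
  shows "A = four_block_mat
      (Matrix.mat n n (\<lambda>(i, j). A $$ (i, j) - A $$ (i, n) * A $$ (n, j) / A $$ (n, n)))
      (Matrix.mat n 1 (\<lambda>(i, _). A $$ (i, n))) (0\<^sub>m 1 n) (Matrix.mat 1 1 (\<lambda>_. A $$ (n, n)))
    * four_block_mat (1\<^sub>m n) (0\<^sub>m n 1)
      (Matrix.mat 1 n (\<lambda>(_, j). A $$ (n, j) / A $$ (n, n))) (Matrix.mat 1 1 (\<lambda>_. 1))"
  (is "A = four_block_mat ?B ?c ?z ?a * four_block_mat ?o ?z' ?r ?u")
proof -
  have "four_block_mat ?B ?c ?z ?a * four_block_mat ?o ?z' ?r ?u
    = four_block_mat (?B * ?o + ?c * ?r) (?B * ?z' + ?c * ?u) (?z * ?o + ?a * ?r) (?z * ?z' + ?a * ?u)"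
    by (rule mult_four_block_mat[of _ n n _ 1 _ 1 _ _ n _ 1]) auto
  also have "\<dots> = A"
  proof (rule eq_matI)
    fix i j assume ij: "i < dim_row A" "j < dim_col A"
    have i: "i = n" if "\<not> i < n" using ij that A by auto
    have j: "j = n" if "\<not> j < n" using ij that A by auto
    show "four_block_mat (?B * ?o + ?c * ?r) (?B * ?z' + ?c * ?u) (?z * ?o + ?a * ?r)
        (?z * ?z' + ?a * ?u) $$ (i, j) = A $$ (i, j)"
      using ij A a by (cases "i < n"; cases "j < n") (auto simp: scalar_prod_def dest: i j)
  qed (use A in auto)
  finally show ?thesis by simp
qed

text \<open>Induction from the bottom row: a column swap brings an entry of minimal valuation of the
  last row to the corner, integral column operations clear the rest of that row, and the Schur
  complement, again nonsingular, is decomposed recursively.\<close>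

lemma Iwasawa_decomposition:
  fixes A :: "'p::prime_card padic mat"
  assumes "A \<in> carrier_mat n n" "det A \<noteq> 0"
  shows "\<exists>T V. T \<in> carrier_mat n n \<and> upper_triangular T \<and> V \<in> GL_Zp n \<and> A = T * V"
  using assms
proof (induction n arbitrary: A)
  case 0
  then show ?case by (intro exI[of _ A] exI[of _ "1\<^sub>m 0"]) (auto simp: one_in_GL_Zp)
next
  case (Suc n)
  obtain j0 where "j0 < Suc n" "A $$ (n, j0) \<noteq> 0"
    using row_nonzero_if_det_nonzero[OF Suc.prems, of n] by auto
  then obtain s where s: "s < Suc n" "A $$ (n, s) \<noteq> 0"
    and min: "\<And>l. l < Suc n \<Longrightarrow> A $$ (n, l) / A $$ (n, s) \<in> Zp"
    using ex_min_pval[of "{..<Suc n}" j0 "\<lambda>j. A $$ (n, j)"] by auto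
  define Q :: "'p padic mat" where "Q = swaprows_mat (Suc n) s n"
  have Q: "Q \<in> GL_Zp (Suc n)" unfolding Q_def using s by (intro swaprows_mat_in_GL_Zp) auto
  define A' where "A' = swapcols s n A"
  have A': "A' \<in> carrier_mat (Suc n) (Suc n)" using Suc.prems by (auto simp: A'_def)
  have A'Q: "A' = A * Q"
    unfolding A'_def Q_def using Suc.prems s by (intro swapcols_mat[of _ "Suc n"]) auto
  let ?a = "A' $$ (n, n)"
  have an: "?a = A $$ (n, s)" using Suc.prems s by (auto simp: A'_def)
  have a: "?a \<noteq> 0" using s an by simp
  \<comment> \<open>These quotients are the multipliers of the elimination; their integrality puts
    \<open>?R\<close> into \<open>GL_Zp\<close>.\<close>
  have min': "A' $$ (n, j) / ?a \<in> Zp" if "j < Suc n" for j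
    using min[of j] min[of n] min[of s] that Suc.prems s unfolding an by (auto simp: A'_def)
  let ?B = "Matrix.mat n n (\<lambda>(i, j). A' $$ (i, j) - A' $$ (i, n) * A' $$ (n, j) / ?a)"
  let ?c = "Matrix.mat n 1 (\<lambda>(i, _). A' $$ (i, n))"
  let ?r = "Matrix.mat 1 n (\<lambda>(_, j). A' $$ (n, j) / ?a)"
  let ?aa = "Matrix.mat 1 1 (\<lambda>_. ?a)"
  let ?R = "four_block_mat (1\<^sub>m n) (0\<^sub>m n 1) ?r (Matrix.mat 1 1 (\<lambda>_. 1))"
  have R: "?R \<in> GL_Zp (Suc n)"
    using min' by (intro four_block_lower_in_GL_Zp one_in_GL_Zp Zp_units_1) (auto simp: Zp_mat_def)
  have fac: "A' = four_block_mat ?B ?c (0\<^sub>m 1 n) ?aa * ?R"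
    using clear_last_row[OF A' a] .
  have "det A' \<noteq> 0"
    using det_mult[OF Suc.prems(1) GL_ZpD(2)[OF Q]] GL_ZpD(3)[OF Q] Suc.prems(2)
    by (auto simp: A'Q Zp_units_def)
  moreover have "det A' = det (four_block_mat ?B ?c (0\<^sub>m 1 n) ?aa) * det ?R"
    by (subst fac, rule det_mult[OF _ GL_ZpD(2)[OF R]]) auto
  moreover have "det (four_block_mat ?B ?c (0\<^sub>m 1 n) ?aa) = det ?B * det ?aa"
    by (rule det_four_block_mat_lower_left_zero) auto
  ultimately have "det ?B \<noteq> 0" by auto
  then obtain T V where T: "T \<in> carrier_mat n n" "upper_triangular T" and V: "V \<in> GL_Zp n"
    and B: "?B = T * V"
    using Suc.IH[of ?B] by auto
  \<comment> \<open>The factors of the Schur complement are bordered; the corner entry 1 of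
    \<open>?V\<close> keeps the last column \<open>?c\<close> unchanged.\<close>
  let ?T = "four_block_mat T ?c (0\<^sub>m 1 n) ?aa"
  let ?V = "four_block_mat V (0\<^sub>m n 1) (0\<^sub>m 1 n) (Matrix.mat 1 1 (\<lambda>_. 1))"
  note Vc = GL_ZpD(2)[OF V]
  have V': "?V \<in> GL_Zp (Suc n)"
    using V by (intro four_block_lower_in_GL_Zp Zp_units_1) (auto simp: Zp_mat_def)
  have "?T * ?V = four_block_mat (T * V + ?c * 0\<^sub>m 1 n) (T * 0\<^sub>m n 1 + ?c * Matrix.mat 1 1 (\<lambda>_. 1))
      (0\<^sub>m 1 n * V + ?aa * 0\<^sub>m 1 n) (0\<^sub>m 1 n * 0\<^sub>m n 1 + ?aa * Matrix.mat 1 1 (\<lambda>_. 1))"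
    by (rule mult_four_block_mat[of _ n n _ 1 _ 1 _ _ n _ 1]) (use T Vc in auto)
  also have "\<dots> = four_block_mat ?B ?c (0\<^sub>m 1 n) ?aa"
    unfolding B using T Vc by (intro cong_four_block_mat) (auto simp: scalar_prod_def)
  finally have TV: "?T * ?V = four_block_mat ?B ?c (0\<^sub>m 1 n) ?aa" .
  obtain Q' where Q': "Q' \<in> GL_Zp (Suc n)" "Q * Q' = 1\<^sub>m (Suc n)" using GL_Zp_inverse[OF Q] .
  have Tc: "?T \<in> carrier_mat (Suc n) (Suc n)" using T by (auto intro!: carrier_matI)
  have "A = A' * Q'"
    using Suc.prems(1) GL_ZpD(2)[OF Q] GL_ZpD(2)[OF Q'(1)] Q'(2)
    by (simp add: A'Q assoc_mult_mat[of _ "Suc n" "Suc n" _ "Suc n" _ "Suc n"])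
  also have "\<dots> = ?T * ?V * ?R * Q'" unfolding TV using fac by simp
  also have "\<dots> = ?T * (?V * ?R * Q')"
    using Tc GL_ZpD(2)[OF V'] GL_ZpD(2)[OF R] GL_ZpD(2)[OF Q'(1)]
    by (simp only: assoc_mult_mat[of _ "Suc n" "Suc n" _ "Suc n" _ "Suc n"]
        mult_carrier_mat[of _ "Suc n" "Suc n" _ "Suc n"])
  finally have "A = ?T * (?V * ?R * Q')" .
  moreover have "?V * ?R * Q' \<in> GL_Zp (Suc n)"
    by (intro GL_Zp_mult V' R Q'(1))
  moreover have "upper_triangular ?T"
    by (rule upper_triangular_four_block[OF T(1) _ T(2)]) auto
  ultimately show ?case using Tc by blast
qed

lemma smult_mult_mult_mat:
  fixes A :: "'a::comm_ring_1 mat"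
  assumes "A \<in> carrier_mat n m" "U \<in> carrier_mat n n" "V \<in> carrier_mat m m"
  shows "c \<cdot>\<^sub>m (U * A * V) = U * (c \<cdot>\<^sub>m A) * V"
  using assms by (simp add: mult_smult_distrib[of _ n n] mult_smult_assoc_mat[of _ n m])

lemma Zp_mat_smult_mult:
  assumes "c \<cdot>\<^sub>m A \<in> Zp_mat n m" "A \<in> carrier_mat n m" "U \<in> Zp_mat n n" "V \<in> Zp_mat m m"
  shows "c \<cdot>\<^sub>m (U * A * V) \<in> Zp_mat n m"
  using assms smult_mult_mult_mat[OF assms(2) Zp_mat_carrier[OF assms(3)] Zp_mat_carrier[OF assms(4)]]
  by (auto intro: Zp_mat_mult)

lemma GL_Zp_equiv_sym:
  fixes A :: "'p::prime_card padic mat"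
  assumes "B \<in> carrier_mat n m" "U \<in> GL_Zp n" "V \<in> GL_Zp m" "A = U * B * V"
  obtains U' V' where "U' \<in> GL_Zp n" "V' \<in> GL_Zp m" "B = U' * A * V'"
proof -
  obtain X where X: "X \<in> GL_Zp n" "X * U = 1\<^sub>m n" using GL_Zp_inverse[OF assms(2)] .
  obtain Y where Y: "Y \<in> GL_Zp m" "V * Y = 1\<^sub>m m" using GL_Zp_inverse[OF assms(3)] .
  note carr = assms(1) GL_ZpD(2)[OF assms(2)] GL_ZpD(2)[OF assms(3)] GL_ZpD(2)[OF X(1)] GL_ZpD(2)[OF Y(1)]
  have "X * A * Y = (X * U) * B * (V * Y)"
    unfolding assms(4) using carr
    by (simp only: assoc_mult_mat[of _ n n _ n _ m] assoc_mult_mat[of _ n n _ m _ m]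
          assoc_mult_mat[of _ n m _ m _ m] mult_carrier_mat[of _ n n _ m]
          mult_carrier_mat[of _ n m _ m] mult_carrier_mat[of _ m m _ m])
  also have "\<dots> = B" unfolding X Y using carr by simp
  finally show thesis using that X Y by metis
qed

text \<open>The pivot now has minimal valuation in the whole matrix, so its row and its column are
  both cleared by integral operations. Its valuation is at most every singular number of the Schur
  complement, which is why it is appended at the end of the non-increasing list.\<close>

lemma Smith_normal_form:
  fixes A :: "'p::prime_card padic mat"
  assumes "A \<in> carrier_mat n n" "det A \<noteq> 0"
  shows "\<exists>ls. is_SN A ls"
  using assms
proof (induction n arbitrary: A)
  case 0
  then have "A = 1\<^sub>m 0 * diag_p 0 0 [] * 1\<^sub>m 0" by (intro eq_matI) auto
  then show ?case by (intro exI[of _ "[]"] is_SNI[of _ 0]) (auto simp: one_in_GL_Zp)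
next
  case (Suc n)
  obtain j0 where "j0 < Suc n" "A $$ (n, j0) \<noteq> 0"
    using row_nonzero_if_det_nonzero[OF Suc.prems, of n] by auto
  then obtain rs where "rs \<in> {..<Suc n} \<times> {..<Suc n}" "A $$ rs \<noteq> 0"
    and "\<And>kl. kl \<in> {..<Suc n} \<times> {..<Suc n} \<Longrightarrow> A $$ kl / A $$ rs \<in> Zp"
    using ex_min_pval[of "{..<Suc n} \<times> {..<Suc n}" "(n, j0)" "\<lambda>ij. A $$ ij"] by auto
  then obtain r s where r: "r < Suc n" and s: "s < Suc n" and rs: "A $$ (r, s) \<noteq> 0"
    and min: "\<And>k l. k < Suc n \<Longrightarrow> l < Suc n \<Longrightarrow> A $$ (k, l) / A $$ (r, s) \<in> Zp"
    by (cases rs) auto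
  let ?P = "swaprows_mat (Suc n) r n :: 'p padic mat" and ?Q = "swaprows_mat (Suc n) s n :: 'p padic mat"
  have PQ: "?P \<in> GL_Zp (Suc n)" "?Q \<in> GL_Zp (Suc n)"
    using r s by (auto intro!: swaprows_mat_in_GL_Zp)
  define A' where "A' = swaprows r n (swapcols s n A)"
  have A': "A' \<in> carrier_mat (Suc n) (Suc n)" using Suc.prems by (auto simp: A'_def)
  have A'_eq: "A' = ?P * A * ?Q"
  proof -
    have "swapcols s n A = A * ?Q"
      using Suc.prems s by (intro swapcols_mat[of _ "Suc n"]) auto
    moreover have "swaprows r n (A * ?Q) = ?P * (A * ?Q)"
      using Suc.prems r by (intro swaprows_mat[of _ "Suc n" "Suc n"]) auto
    ultimately show ?thesis
      using Suc.prems(1) by (simp add: A'_def assoc_mult_mat[of _ "Suc n" "Suc n" _ "Suc n" _ "Suc n"])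
  qed
  let ?a = "A' $$ (n, n)"
  have an: "?a = A $$ (r, s)" using Suc.prems r s by (auto simp: A'_def)
  have a: "?a \<noteq> 0" using rs an by simp
  \<comment> \<open>The swaps only permute entries; the instances of \<open>min\<close> cover every
    position an entry can come from.\<close>
  have min': "A' $$ (i, j) / ?a \<in> Zp" if "i < Suc n" "j < Suc n" for i j
    using that Suc.prems r s min[of n n] min[of n s] min[of n j] min[of r n] min[of r s] min[of r j]
      min[of i n] min[of i s] min[of i j] unfolding an by (auto simp: A'_def)
  let ?B = "Matrix.mat n n (\<lambda>(i, j). A' $$ (i, j) - A' $$ (i, n) * A' $$ (n, j) / ?a)"
  let ?c = "Matrix.mat n 1 (\<lambda>(i, _). A' $$ (i, n))"
  let ?c' = "Matrix.mat n 1 (\<lambda>(i, _). A' $$ (i, n) / ?a)"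
  let ?r = "Matrix.mat 1 n (\<lambda>(_, j). A' $$ (n, j) / ?a)"
  let ?aa = "Matrix.mat 1 1 (\<lambda>_. ?a)"
  let ?R = "four_block_mat (1\<^sub>m n) (0\<^sub>m n 1) ?r (Matrix.mat 1 1 (\<lambda>_. 1))"
  let ?L = "four_block_mat (1\<^sub>m n) ?c' (0\<^sub>m 1 n) (1\<^sub>m 1)"
  have R: "?R \<in> GL_Zp (Suc n)"
    using min' by (intro four_block_lower_in_GL_Zp one_in_GL_Zp Zp_units_1) (auto simp: Zp_mat_def)
  have L: "?L \<in> GL_Zp (Suc n)"
    using min' by (intro four_block_upper_in_GL_Zp) (auto simp: Zp_mat_def)
  have fac: "A' = four_block_mat ?B ?c (0\<^sub>m 1 n) ?aa * ?R"
    using clear_last_row[OF A' a] .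
  have det_A': "det A' = det ?P * det A * det ?Q"
    unfolding A'_eq using Suc.prems(1) GL_ZpD(2)[OF PQ(1)] GL_ZpD(2)[OF PQ(2)]
    by (simp only: det_mult[of _ "Suc n"] mult_carrier_mat[of _ "Suc n" "Suc n"])
  have "det A' \<noteq> 0"
    using GL_ZpD(3)[OF PQ(1)] GL_ZpD(3)[OF PQ(2)] Suc.prems(2) unfolding det_A' Zp_units_def by simp
  moreover have "det A' = det (four_block_mat ?B ?c (0\<^sub>m 1 n) ?aa) * det ?R"
    by (subst fac, rule det_mult[OF _ GL_ZpD(2)[OF R]]) auto
  moreover have "det (four_block_mat ?B ?c (0\<^sub>m 1 n) ?aa) = det ?B * det ?aa"
    by (rule det_four_block_mat_lower_left_zero) auto
  ultimately have "det ?B \<noteq> 0" by auto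
  then obtain ls where "is_SN ?B ls" using Suc.IH[of ?B] by auto
  then obtain U0 V0 where len: "length ls = n" and sorted: "sorted_wrt (\<ge>) ls"
    and U0: "U0 \<in> GL_Zp n" and V0: "V0 \<in> GL_Zp n" and B: "?B = U0 * diag_p n n ls * V0"
    by (rule is_SNE[of _ _ n n]) auto
  \<comment> \<open>Only the power of p in the pivot may stay on the diagonal; its unit part u
    becomes the corner of \<open>?V0\<close>.\<close>
  obtain u where u: "u \<in> Zp_units" "?a = u * \<pp> powi pval ?a" using pval_decomp[OF a] .
  let ?ls = "ls @ [pval ?a]"
  let ?U0 = "four_block_mat U0 (0\<^sub>m n 1) (0\<^sub>m 1 n) (Matrix.mat 1 1 (\<lambda>_. 1))"
  let ?V0 = "four_block_mat V0 (0\<^sub>m n 1) (0\<^sub>m 1 n) (Matrix.mat 1 1 (\<lambda>_. u))"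
  let ?e = "Matrix.mat 1 1 (\<lambda>_. \<pp> powi pval ?a) :: 'p padic mat"
  have U0': "?U0 \<in> GL_Zp (Suc n)"
    by (rule four_block_lower_in_GL_Zp[OF U0 _ Zp_units_1]) (simp add: Zp_mat_def)
  have V0': "?V0 \<in> GL_Zp (Suc n)"
    by (rule four_block_lower_in_GL_Zp[OF V0 _ u(1)]) (simp add: Zp_mat_def)
  note carr = GL_ZpD(2)[OF U0] GL_ZpD(2)[OF V0]
  have diag: "diag_p (Suc n) (Suc n) ?ls = four_block_mat (diag_p n n ls) (0\<^sub>m n 1) (0\<^sub>m 1 n) ?e"
    using len by (intro eq_matI) (auto simp: diag_p_def nth_append)
  have "?U0 * diag_p (Suc n) (Suc n) ?ls = four_block_mat
      (U0 * diag_p n n ls + 0\<^sub>m n 1 * 0\<^sub>m 1 n) (U0 * 0\<^sub>m n 1 + 0\<^sub>m n 1 * ?e)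
      (0\<^sub>m 1 n * diag_p n n ls + Matrix.mat 1 1 (\<lambda>_. 1) * 0\<^sub>m 1 n)
      (0\<^sub>m 1 n * 0\<^sub>m n 1 + Matrix.mat 1 1 (\<lambda>_. 1) * ?e)"
    unfolding diag by (rule mult_four_block_mat[of _ n n _ 1 _ 1 _ _ n _ 1]) (use carr in auto)
  also have "\<dots> = four_block_mat (U0 * diag_p n n ls) (0\<^sub>m n 1) (0\<^sub>m 1 n) ?e"
    using carr by (intro cong_four_block_mat) (auto simp: scalar_prod_def diag_p_def)
  finally have "?U0 * diag_p (Suc n) (Suc n) ?ls * ?V0
      = four_block_mat (U0 * diag_p n n ls) (0\<^sub>m n 1) (0\<^sub>m 1 n) ?e * ?V0" by simp
  also have "\<dots> = four_block_mat
      (U0 * diag_p n n ls * V0 + 0\<^sub>m n 1 * 0\<^sub>m 1 n)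
      (U0 * diag_p n n ls * 0\<^sub>m n 1 + 0\<^sub>m n 1 * Matrix.mat 1 1 (\<lambda>_. u))
      (0\<^sub>m 1 n * V0 + ?e * 0\<^sub>m 1 n) (0\<^sub>m 1 n * 0\<^sub>m n 1 + ?e * Matrix.mat 1 1 (\<lambda>_. u))"
    by (rule mult_four_block_mat[of _ n n _ 1 _ 1 _ _ n _ 1]) (use carr in auto)
  also have "\<dots> = four_block_mat ?B (0\<^sub>m n 1) (0\<^sub>m 1 n) ?aa"
  proof (intro cong_four_block_mat)
    show "U0 * diag_p n n ls * V0 + 0\<^sub>m n 1 * 0\<^sub>m 1 n = ?B"
      unfolding B [symmetric] by (rule eq_matI) auto
    show "0\<^sub>m 1 n * 0\<^sub>m n 1 + ?e * Matrix.mat 1 1 (\<lambda>_. u) = ?aa"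
      by (rule eq_matI) (auto simp: scalar_prod_def mult.commute u(2)[symmetric])
  qed (use carr in \<open>auto simp: scalar_prod_def\<close>)
  finally have UDV: "?U0 * diag_p (Suc n) (Suc n) ?ls * ?V0 = four_block_mat ?B (0\<^sub>m n 1) (0\<^sub>m 1 n) ?aa" .
  \<comment> \<open>The column above the pivot is restored by a row operation, with
    \<open>?c'\<close> equal to \<open>?c\<close> divided by the pivot.\<close>
  have "?L * four_block_mat ?B (0\<^sub>m n 1) (0\<^sub>m 1 n) ?aa = four_block_mat
      (1\<^sub>m n * ?B + ?c' * 0\<^sub>m 1 n) (1\<^sub>m n * 0\<^sub>m n 1 + ?c' * ?aa)
      (0\<^sub>m 1 n * ?B + 1\<^sub>m 1 * 0\<^sub>m 1 n) (0\<^sub>m 1 n * 0\<^sub>m n 1 + 1\<^sub>m 1 * ?aa)"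
    by (rule mult_four_block_mat[of _ n n _ 1 _ 1 _ _ n _ 1]) auto
  also have "\<dots> = four_block_mat ?B ?c (0\<^sub>m 1 n) ?aa"
    using a by (intro cong_four_block_mat) (auto simp: scalar_prod_def)
  finally have LB: "?L * four_block_mat ?B (0\<^sub>m n 1) (0\<^sub>m 1 n) ?aa = four_block_mat ?B ?c (0\<^sub>m 1 n) ?aa" .
  have A'_diag: "A' = (?L * ?U0) * diag_p (Suc n) (Suc n) ?ls * (?V0 * ?R)"
  proof -
    have "A' = ?L * (?U0 * diag_p (Suc n) (Suc n) ?ls * ?V0) * ?R"
      unfolding UDV LB by (rule fac)
    also have "\<dots> = (?L * ?U0) * diag_p (Suc n) (Suc n) ?ls * (?V0 * ?R)"
      using GL_ZpD(2)[OF L] GL_ZpD(2)[OF U0'] GL_ZpD(2)[OF V0'] GL_ZpD(2)[OF R]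
      by (simp only: assoc_mult_mat[of _ "Suc n" "Suc n" _ "Suc n" _ "Suc n"]
          mult_carrier_mat[of _ "Suc n" "Suc n" _ "Suc n"] diag_p_carrier)
    finally show ?thesis .
  qed
  obtain P' Q' where P': "P' \<in> GL_Zp (Suc n)" and Q': "Q' \<in> GL_Zp (Suc n)" and "A = P' * A' * Q'"
    using GL_Zp_equiv_sym[OF Suc.prems(1) PQ A'_eq] .
  then have "A = P' * ((?L * ?U0) * diag_p (Suc n) (Suc n) ?ls * (?V0 * ?R)) * Q'"
    using A'_diag by simp
  also have "\<dots> = (P' * (?L * ?U0)) * diag_p (Suc n) (Suc n) ?ls * (?V0 * ?R * Q')"
    using GL_ZpD(2)[OF L] GL_ZpD(2)[OF U0'] GL_ZpD(2)[OF V0'] GL_ZpD(2)[OF R]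
      GL_ZpD(2)[OF P'] GL_ZpD(2)[OF Q']
    by (simp only: assoc_mult_mat[of _ "Suc n" "Suc n" _ "Suc n" _ "Suc n"]
        mult_carrier_mat[of _ "Suc n" "Suc n" _ "Suc n"] diag_p_carrier)
  finally have A_diag: "A = (P' * (?L * ?U0)) * diag_p (Suc n) (Suc n) ?ls * (?V0 * ?R * Q')" .
  \<comment> \<open>The Schur complement divided by the pivot is integral, and remains so under
    multiplication by integral matrices; hence the pivot divides each
    \<open>\<pp> powi (ls ! i)\<close>.\<close>
  have "pval ?a \<le> ls ! i" if i: "i < n" for i
  proof -
    obtain U1 V1 where UV1: "U1 \<in> GL_Zp n" "V1 \<in> GL_Zp n" and D: "diag_p n n ls = U1 * ?B * V1"
      using GL_Zp_equiv_sym[OF diag_p_carrier U0 V0 B] .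
    have "?B $$ (k, l) / ?a \<in> Zp" if "k < n" "l < n" for k l
    proof -
      have "A' $$ (k, l) / ?a + - (A' $$ (k, n) / ?a * (A' $$ (n, l) / ?a)) \<in> Zp"
        using that by (intro Zp_add Zp_uminus Zp_mult min') auto
      then show ?thesis using that by (simp add: diff_divide_distrib)
    qed
    then have "inverse ?a \<cdot>\<^sub>m ?B \<in> Zp_mat n n"
      by (auto simp: Zp_mat_def divide_inverse mult.commute)
    then have "inverse ?a \<cdot>\<^sub>m diag_p n n ls \<in> Zp_mat n n"
      unfolding D using UV1 GL_ZpD(1) by (intro Zp_mat_smult_mult) auto
    then have "(inverse ?a \<cdot>\<^sub>m diag_p n n ls) $$ (i, i) \<in> Zp"
      using i i by (rule Zp_mat_index)
    then have "\<pp> powi (ls ! i) / ?a \<in> Zp"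
      using i by (simp add: diag_p_def divide_inverse mult.commute)
    then show ?thesis using a by (simp add: divide_in_Zp_iff)
  qed
  then have "sorted_wrt (\<ge>) ?ls"
    using sorted len by (auto simp: sorted_wrt_append in_set_conv_nth)
  then have "is_SN A ?ls"
    using len by (intro is_SNI[OF _ _ _ _ A_diag] GL_Zp_mult P' L U0' V0' R Q') simp_all
  then show ?case by blast
qed

section \<open>Triangular matrices and corners\<close>

lemma mult_mat_index:
  assumes "A \<in> carrier_mat n k" "B \<in> carrier_mat k m" "i < n" "j < m"
  shows "(A * B) $$ (i, j) = (\<Sum>l = 0..<k. A $$ (i, l) * B $$ (l, j))"
  using assms by (simp add: scalar_prod_def)

lemma pick_atLeast: "pick {k..} r = k + r"
proof (induction r)
  case 0
  show ?case by (auto intro: Least_equality)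
next
  case (Suc r)
  then show ?case by (auto intro: Least_equality)
qed

lemma last_rows_eq:
  assumes "A \<in> carrier_mat n m"
  shows "last_rows i A = Matrix.mat (n - (i - 1)) m (\<lambda>(r, c). A $$ (i - 1 + r, c))"
proof -
  have "{r. r < n \<and> i - 1 \<le> r} = {i - 1..<n}" by auto
  then show ?thesis
    using assms unfolding last_rows_def submatrix_def by (auto simp: pick_atLeast pick_UNIV)
qed

lemma GL_ZpI:
  assumes "G \<in> Zp_mat n n" "H \<in> Zp_mat n n" "G * H = 1\<^sub>m n"
  shows "G \<in> GL_Zp n"
proof -
  have "det G * det H = 1"
    using det_mult[OF Zp_mat_carrier[OF assms(1)] Zp_mat_carrier[OF assms(2)]] assms(3) by simp
  moreover from this have "inverse (det G) = det H" by (rule inverse_unique)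
  ultimately have "det G \<in> Zp_units"
    using det_in_Zp[OF assms(1)] det_in_Zp[OF assms(2)] by (auto simp: Zp_units_def)
  then show ?thesis using assms(1) by (simp add: GL_Zp_iff)
qed

text \<open>For n = d + k, right multiplication by this matrix turns \<open>diag_p k n ls\<close>,
  of block shape (D, 0), into (0, D W): it moves the zero columns to the front.\<close>

lemma anti_block_diagonal_in_GL_Zp:
  assumes W: "W \<in> GL_Zp k"
  shows "four_block_mat (0\<^sub>m k d) W (1\<^sub>m d) (0\<^sub>m d k) \<in> GL_Zp (k + d)" (is "?G \<in> _")
proof -
  obtain X where X: "X \<in> GL_Zp k" "W * X = 1\<^sub>m k" using GL_Zp_inverse[OF W] .
  let ?H = "four_block_mat (0\<^sub>m d k) (1\<^sub>m d) X (0\<^sub>m k d)"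
  note carr = GL_ZpD(2)[OF W] GL_ZpD(2)[OF X(1)]
  have "?G * ?H = four_block_mat (0\<^sub>m k d * 0\<^sub>m d k + W * X) (0\<^sub>m k d * 1\<^sub>m d + W * 0\<^sub>m k d)
      (1\<^sub>m d * 0\<^sub>m d k + 0\<^sub>m d k * X) (1\<^sub>m d * 1\<^sub>m d + 0\<^sub>m d k * 0\<^sub>m k d)"
    by (rule mult_four_block_mat[of _ k d _ k _ d _ _ k _ d]) (use carr in auto)
  also have "\<dots> = 1\<^sub>m (k + d)"
    using carr X(2) by (simp add: four_block_one_mat[symmetric] del: four_block_one_mat)
  finally show ?thesis
    using GL_ZpD(1)[OF W] GL_ZpD(1)[OF X(1)]
    by (intro GL_ZpI[of _ _ ?H]) (auto simp: Zp_mat_def)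
qed

lemma det_upper_triangular_prod:
  assumes "upper_triangular T" "T \<in> carrier_mat n n"
  shows "det T = (\<Prod>i<n. T $$ (i, i))"
  using det_upper_triangular[OF assms] prod_list_diag_prod[of T] assms(2)
  by (simp add: atLeast0LessThan)

text \<open>By triangularity the last k rows of T have the block shape (0, \<open>?T\<close>) with
  \<open>?T\<close> the lower right corner. A Smith form of \<open>?T\<close> extends to the
  rectangular matrix, and V is absorbed into its right factor, so the weight is the valuation of
  \<open>det ?T\<close>, the product of the diagonal entries.\<close>

lemma weight_SN_last_rows:
  fixes T :: "'p::prime_card padic mat"
  assumes T: "T \<in> carrier_mat n n" "upper_triangular T" "det T \<noteq> 0"
    and V: "V \<in> GL_Zp n" and i: "i - 1 \<le> n"
  shows "sum_list (SN (last_rows i (T * V))) = (\<Sum>j = i - 1..<n. pval (T $$ (j, j)))"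
proof -
  \<comment> \<open>The number of rows removed, which is also the index from 0 of the first row
    kept.\<close>
  define d where "d = i - 1"
  define k where "k = n - d"
  have n: "n = d + k" using i by (simp add: k_def d_def)
  note Vc = GL_ZpD(2)[OF V]
  let ?T = "Matrix.mat k k (\<lambda>(r, c). T $$ (d + r, d + c))"
  have tri: "upper_triangular ?T" using T n by (auto simp: upper_triangular_def)
  have diag0: "T $$ (j, j) \<noteq> 0" if "j < n" for j
    using det_upper_triangular_prod[OF T(2,1)] T(3) that by auto
  have det: "det ?T = (\<Prod>r<k. T $$ (d + r, d + r))"
    using det_upper_triangular_prod[OF tri, of k] by simp
  then have det0: "det ?T \<noteq> 0" using diag0 n by simp
  obtain ls where "is_SN ?T ls" using Smith_normal_form[of ?T k] det0 by auto
  then obtain U W where len: "length ls = k" and sorted: "sorted_wrt (\<ge>) ls"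
    and U: "U \<in> GL_Zp k" and W: "W \<in> GL_Zp k" and UDW: "?T = U * diag_p k k ls * W"
    by (rule is_SNE[of _ _ k k]) auto
  let ?G = "four_block_mat (0\<^sub>m k d) W (1\<^sub>m d) (0\<^sub>m d k)"
  have G: "?G \<in> GL_Zp n"
    using anti_block_diagonal_in_GL_Zp[OF W, of d] by (simp add: n add.commute)
  note carr = GL_ZpD(2)[OF U] GL_ZpD(2)[OF W] GL_ZpD(2)[OF G]
  let ?N = "Matrix.mat k n (\<lambda>(r, c). T $$ (d + r, c))"
  have N: "?N = U * diag_p k n ls * ?G"
  proof -
    have "?N = U * (diag_p k n ls * ?G)"
    proof (rule eq_matI)
      fix r c assume "r < dim_row (U * (diag_p k n ls * ?G))" "c < dim_col (U * (diag_p k n ls * ?G))"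
      then have r: "r < k" and c: "c < n" using carr n by auto
      have Gl: "(diag_p k n ls * ?G) $$ (l, c) = (if c < d then 0 else (diag_p k k ls * W) $$ (l, c - d))"
        if "l < k" for l
        using that c n carr diag_p_mult_index[OF carr(3), of k l c ls]
          diag_p_mult_index[OF carr(2), of k l "c - d" ls] by auto
      have "(U * (diag_p k n ls * ?G)) $$ (r, c) = (\<Sum>l = 0..<k. U $$ (r, l) * (diag_p k n ls * ?G) $$ (l, c))"
        by (rule mult_mat_index[OF carr(1) mult_carrier_mat[OF diag_p_carrier carr(3)] r c])
      also have "\<dots> = (if c < d then 0 else (\<Sum>l = 0..<k. U $$ (r, l) * (diag_p k k ls * W) $$ (l, c - d)))"
        using Gl by simp
      also have "(\<Sum>l = 0..<k. U $$ (r, l) * (diag_p k k ls * W) $$ (l, c - d)) = ?T $$ (r, c - d)"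
        if "\<not> c < d"
      proof -
        have "?T = U * (diag_p k k ls * W)"
          using UDW assoc_mult_mat[OF carr(1) diag_p_carrier carr(2), of ls] by simp
        then have "?T $$ (r, c - d) = (U * (diag_p k k ls * W)) $$ (r, c - d)" by (rule arg_cong)
        then show ?thesis
          using mult_mat_index[OF carr(1) mult_carrier_mat[OF diag_p_carrier carr(2)] r, of "c - d" ls]
            c n that by simp
      qed
      then have "(if c < d then 0 else (\<Sum>l = 0..<k. U $$ (r, l) * (diag_p k k ls * W) $$ (l, c - d)))
          = (if c < d then 0 else ?T $$ (r, c - d))" by auto
      \<comment> \<open>The first d columns of these rows lie below the diagonal of T.\<close>
      also have "\<dots> = ?N $$ (r, c)"
        using T r c n by (auto simp: upper_triangular_def)
      finally show "?N $$ (r, c) = (U * (diag_p k n ls * ?G)) $$ (r, c)" by simp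
    qed (use carr n in auto)
    then show ?thesis
      using assoc_mult_mat[OF carr(1) diag_p_carrier carr(3), of ls] by simp
  qed
  have "last_rows i (T * V) = ?N * V"
    unfolding last_rows_eq[OF mult_carrier_mat[OF T(1) Vc]] d_def [symmetric] k_def [symmetric]
  proof (rule eq_matI)
    fix r c assume "r < dim_row (?N * V)" "c < dim_col (?N * V)"
    then have r: "r < k" "d + r < n" and c: "c < n" using Vc n by auto
    show "Matrix.mat k n (\<lambda>(r, c). (T * V) $$ (d + r, c)) $$ (r, c) = (?N * V) $$ (r, c)"
      using mult_mat_index[OF T(1) Vc r(2) c] r c
      by (simp add: mult_mat_index[OF mat_carrier Vc] del: index_mult_mat)
  qed (use Vc in auto)
  also have "\<dots> = U * diag_p k n ls * (?G * V)"
    unfolding N using carr Vc by (intro assoc_mult_mat[of _ k n _ n _ n]) auto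
  finally have "is_SN (last_rows i (T * V)) ls"
    using len sorted U GL_Zp_mult[OF G V] by (intro is_SNI[of _ k _ _ n])
  moreover have "dim_row (last_rows i (T * V)) \<le> dim_col (last_rows i (T * V))"
    unfolding last_rows_eq[OF mult_carrier_mat[OF T(1) Vc]] by simp
  ultimately have SN: "SN (last_rows i (T * V)) = ls" by (rule SN_eqI)
  \<comment> \<open>The two unit determinants do not change the valuation, so the weight can be read
    off from \<open>det ?T\<close>.\<close>
  have "det ?T = (det U * det W) * \<pp> powi sum_list ls"
    unfolding UDW using carr len
    by (simp add: det_mult[of _ k] mult_carrier_mat[of _ k k] det_diag_p)
  then have "pval (det ?T) = sum_list ls"
    by (simp only: pval_unit_powi[OF Zp_units_mult[OF GL_ZpD(3)[OF U] GL_ZpD(3)[OF W]]])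
  moreover have "pval (det ?T) = (\<Sum>r<k. pval (T $$ (d + r, d + r)))"
    unfolding det using diag0 n by (intro pval_prod) auto
  moreover have "\<dots> = (\<Sum>j = d..<n. pval (T $$ (j, j)))"
    unfolding n by (rule sum.reindex_bij_witness[of _ "\<lambda>j. j - d" "\<lambda>r. d + r"]) auto
  ultimately show ?thesis by (simp add: SN d_def)
qed

section \<open>Left multiplication by a diagonal matrix: the triangular case and the Lipschitz
  bound\<close>

lemma SN_last_le_pval:
  fixes A :: "'p::prime_card padic mat"
  assumes "is_SN A ls" "A \<in> carrier_mat n n" "i < n" "j < n" "A $$ (i, j) \<noteq> 0"
  shows "ls ! (n - 1) \<le> pval (A $$ (i, j))"
proof -
  let ?e = "ls ! (n - 1)"
  obtain U V where len: "length ls = n" and sorted: "sorted_wrt (\<ge>) ls"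
    and U: "U \<in> GL_Zp n" and V: "V \<in> GL_Zp n" and A: "A = U * diag_p n n ls * V"
    using is_SNE[OF assms(1,2)] .
  have "?e \<le> ls ! k" if "k < n" for k
    using sorted that len by (cases "k = n - 1") (auto simp: sorted_wrt_iff_nth_less)
  \<comment> \<open>The smallest exponent is factored out of the diagonal; the quotient stays
    integral under U and V, so \<open>\<pp> powi ?e\<close> divides all entries of A.\<close>
  then have "\<pp> powi (- ?e) \<cdot>\<^sub>m diag_p n n ls \<in> (Zp_mat n n :: 'p padic mat set)"
    by (auto simp: Zp_mat_def diag_p_def uniformizer_powi_in_Zp_iff simp flip: power_int_add)
  then have "\<pp> powi (- ?e) \<cdot>\<^sub>m A \<in> Zp_mat n n"
    unfolding A using GL_ZpD(1) U V by (intro Zp_mat_smult_mult) auto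
  then have "\<pp> powi (- ?e) * A $$ (i, j) \<in> Zp"
    using Zp_mat_index[of _ n n i j] assms by fastforce
  then have "A $$ (i, j) / \<pp> powi ?e \<in> Zp"
    by (simp add: power_int_minus divide_inverse mult.commute)
  then show ?thesis using assms(5) by (simp add: divide_in_Zp_iff)
qed

lemma is_SN_mult_right:
  assumes "is_SN (A * V) ls" "A \<in> carrier_mat n n" "V \<in> GL_Zp n"
  shows "is_SN A ls"
proof -
  note Vc = GL_ZpD(2)[OF assms(3)]
  obtain U W where UW: "length ls = n" "sorted_wrt (\<ge>) ls"
    "U \<in> GL_Zp n" "W \<in> GL_Zp n" "A * V = U * diag_p n n ls * W"
    using is_SNE[OF assms(1) mult_carrier_mat[OF assms(2) Vc]] .
  obtain Y where Y: "Y \<in> GL_Zp n" "V * Y = 1\<^sub>m n" using GL_Zp_inverse[OF assms(3)] .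
  note carr = Vc GL_ZpD(2)[OF UW(3)] GL_ZpD(2)[OF UW(4)] GL_ZpD(2)[OF Y(1)]
  have "A = A * V * Y"
    using assms(2) carr Y(2) by (simp add: assoc_mult_mat[of _ n n _ n _ n])
  also have "\<dots> = U * diag_p n n ls * (W * Y)"
    unfolding UW(5) using carr by (intro assoc_mult_mat[of _ n n _ n _ n] mult_carrier_mat[of _ n n]) auto
  finally show ?thesis
    using UW GL_Zp_mult[OF UW(4) Y(1)] by (intro is_SNI[of _ n _ _ n])
qed

text \<open>The left factor U is T with row i scaled by the exponent \<open>a ! i\<close> and column
  j by \<open>- b ! j\<close>. Its diagonal entries are units by the choice of b. Above the
  diagonal, \<open>b ! j \<le> b ! Suc i\<close> and
  \<open>pval (T $$ (i, j)) \<ge> nu ! (n - 1)\<close>, so \<open>split\<close> makes the entries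
  integral and \<open>U * diag_p n n b * V\<close> is a Smith form.\<close>

lemma is_SN_diag_mult_triangular:
  fixes T :: "'p::prime_card padic mat"
  assumes T: "T \<in> carrier_mat n n" "upper_triangular T" "det T \<noteq> 0" and V: "V \<in> GL_Zp n"
    and nu: "is_SN (T * V) nu"
    and len: "length b = n" and sorted: "sorted_wrt (\<ge>) b"
    and b: "\<And>i. i < n \<Longrightarrow> b ! i = a ! i + pval (T $$ (i, i))"
    and split: "\<And>i. Suc i < n \<Longrightarrow> a ! i - b ! Suc i + nu ! (n - 1) \<ge> 0"
  shows "is_SN (diag_p n n a * (T * V)) b"
proof -
  have nuT: "is_SN T nu" using is_SN_mult_right[OF nu T(1) V] .
  have diag0: "T $$ (j, j) \<noteq> 0" if "j < n" for j
    using det_upper_triangular_prod[OF T(2,1)] T(3) that by auto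
  define U where "U = Matrix.mat n n (\<lambda>(i, j). T $$ (i, j) * \<pp> powi (a ! i - b ! j))"
  have Uc: "U \<in> carrier_mat n n" by (simp add: U_def)
  have Uii: "U $$ (i, i) \<in> Zp_units" if i: "i < n" for i
  proof -
    have "U $$ (i, i) \<noteq> 0" "pval (U $$ (i, i)) = 0"
      using i diag0[OF i] b[OF i] by (simp_all add: U_def pval_mult)
    then show ?thesis by (simp add: Zp_units_iff_pval)
  qed
  have Uij: "U $$ (i, j) \<in> Zp" if i: "i < n" and j: "j < n" for i j
  proof (cases "T $$ (i, j) = 0")
    case True
    then show ?thesis using i j by (simp add: U_def)
  next
    case False
    then have "i \<le> j" using T i j by (auto simp: upper_triangular_def not_less[symmetric])
    show ?thesis
    proof (cases "i = j")
      case True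
      then show ?thesis using Uii[OF i] by (simp add: Zp_units_def)
    next
      case neq: False
      then have "Suc i \<le> j" using \<open>i \<le> j\<close> by simp
      then have "b ! j \<le> b ! Suc i"
        using sorted len j by (cases "Suc i = j") (auto simp: sorted_wrt_iff_nth_less)
      moreover have "nu ! (n - 1) \<le> pval (T $$ (i, j))"
        using SN_last_le_pval[OF nuT T(1) i j False] .
      ultimately have "pval (U $$ (i, j)) \<ge> 0"
        using split[of i] \<open>Suc i \<le> j\<close> i j False by (simp add: U_def pval_mult)
      moreover have "U $$ (i, j) \<noteq> 0" using i j False by (simp add: U_def)
      ultimately show ?thesis by (simp add: Zp_iff_pval)
    qed
  qed
  have "upper_triangular U" using T by (auto simp: upper_triangular_def U_def)
  then have "det U = (\<Prod>i<n. U $$ (i, i))" using Uc by (rule det_upper_triangular_prod)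
  moreover have "U $$ (i, i) \<noteq> 0 \<and> pval (U $$ (i, i)) = 0" if "i < n" for i
    using Uii[OF that] pval_unit[OF Uii[OF that]] by (simp add: Zp_units_def)
  moreover from this have "pval (\<Prod>i<n. U $$ (i, i)) = (\<Sum>i<n. pval (U $$ (i, i)))"
    by (intro pval_prod) auto
  ultimately have "det U \<noteq> 0" "pval (det U) = 0" by auto
  then have U: "U \<in> GL_Zp n" unfolding GL_Zp_iff using Uc Uij by (simp add: Zp_units_iff_pval Zp_mat_def)
  have "diag_p n n a * T = U * diag_p n n b"
  proof (rule eq_matI)
    fix i j assume "i < dim_row (U * diag_p n n b)" "j < dim_col (U * diag_p n n b)"
    then have ij: "i < n" "j < n" using Uc by (auto simp: diag_p_def)
    then show "(diag_p n n a * T) $$ (i, j) = (U * diag_p n n b) $$ (i, j)"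
      unfolding diag_p_mult_index[OF T(1) order_refl ij] mult_diag_p_index[OF Uc ij]
      by (simp add: U_def power_int_diff)
  qed (use T Uc in \<open>auto simp: diag_p_def\<close>)
  then have "diag_p n n a * (T * V) = U * diag_p n n b * V"
    using assoc_mult_mat[OF diag_p_carrier T(1) GL_ZpD(2)[OF V], of n a] by simp
  then show ?thesis using len sorted U V by (intro is_SNI[of _ n _ _ n])
qed

lemma is_SN_smult:
  fixes B :: "'p::prime_card padic mat"
  assumes "is_SN B b" "B \<in> carrier_mat n n"
  shows "is_SN (\<pp> powi c \<cdot>\<^sub>m B) (map (\<lambda>x. x + c) b)"
proof -
  obtain U V where len: "length b = n" and sorted: "sorted_wrt (\<ge>) b"
    and U: "U \<in> GL_Zp n" and V: "V \<in> GL_Zp n" and B: "B = U * diag_p n n b * V"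
    using is_SNE[OF assms] .
  note carr = GL_ZpD(2)[OF U] GL_ZpD(2)[OF V]
  have "\<pp> powi c \<cdot>\<^sub>m diag_p n n b = (diag_p n n (map (\<lambda>x. x + c) b) :: 'p padic mat)"
    using len by (intro eq_matI) (auto simp: diag_p_def power_int_add mult.commute)
  then have "\<pp> powi c \<cdot>\<^sub>m B = U * diag_p n n (map (\<lambda>x. x + c) b) * V"
    unfolding B using smult_mult_mult_mat[OF diag_p_carrier carr, of "\<pp> powi c" b] by simp
  moreover have "sorted_wrt (\<ge>) (map (\<lambda>x. x + c) b)"
    using sorted by (simp add: sorted_wrt_map)
  ultimately show ?thesis using len U V by (intro is_SNI[of _ n _ _ n]) auto
qed

text \<open>Scaling by \<open>\<pp> powi c\<close> shifts the singular numbers by c and makes the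
  quotient \<open>?E\<close> of the two diagonal matrices integral, so monotonicity applies. Used in
  both directions, this is the Lipschitz property in the maximum norm.\<close>

lemma SN_diag_mult_shift_mono:
  fixes X :: "'p::prime_card padic mat"
  assumes X: "X \<in> carrier_mat n n"
    and a: "is_SN (diag_p n n l * X) a" and b: "is_SN (diag_p n n m * X) b"
    and lm: "\<And>i. i < n \<Longrightarrow> l ! i \<le> m ! i + c" and i: "i < n"
  shows "a ! i \<le> b ! i + c"
proof -
  have lX: "diag_p n n l * X \<in> carrier_mat n n" and mX: "diag_p n n m * X \<in> carrier_mat n n"
    using X by (auto intro: mult_carrier_mat[of _ n n])
  have len: "length b = n" using is_SNE[OF b mX] by metis
  let ?E = "diag_p n n (map (\<lambda>i. m ! i + c - l ! i) [0..<n]) :: 'p padic mat"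
  have E: "?E \<in> Zp_mat n n"
    using lm by (auto simp: Zp_mat_def diag_p_def uniformizer_powi_in_Zp_iff)
  have "\<pp> powi c \<cdot>\<^sub>m (diag_p n n m * X) = ?E * (diag_p n n l * X)"
  proof (rule eq_matI)
    fix r s assume "r < dim_row (?E * (diag_p n n l * X))" "s < dim_col (?E * (diag_p n n l * X))"
    then have rs: "r < n" "s < n" using X by (auto simp: diag_p_def)
    have "(\<pp> powi c \<cdot>\<^sub>m (diag_p n n m * X)) $$ (r, s) = \<pp> powi c * (diag_p n n m * X) $$ (r, s)"
      using rs carrier_matD[OF mX] by (intro index_smult_mat(1)) simp_all
    then show "(\<pp> powi c \<cdot>\<^sub>m (diag_p n n m * X)) $$ (r, s) = (?E * (diag_p n n l * X)) $$ (r, s)"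
      unfolding diag_p_mult_index[OF lX order_refl rs] diag_p_mult_index[OF X order_refl rs]
      using rs by (simp add: power_int_diff power_int_add)
  qed (use X in \<open>auto simp: diag_p_def\<close>)
  then have "a ! i \<le> map (\<lambda>x. x + c) b ! i"
    by (rule is_SN_mono[OF a is_SN_smult[OF b mX] lX order_refl E _ i])
  then show ?thesis using i len by simp
qed

section \<open>The singular numbers of the product\<close>

lemma is_SN_SN:
  fixes A :: "'p::prime_card padic mat"
  assumes "A \<in> carrier_mat n n" "det A \<noteq> 0"
  shows "is_SN A (SN A)"
  using Smith_normal_form[OF assms] SN_eqI[of A] assms(1) by auto

text \<open>The deterministic core, for one fixed sequence of matrices. Coordinates of
  \<open>v k\<close> count from 1 and those of the list \<open>l k\<close> from 0, whence the
  \<open>Suc i\<close>.\<close>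

lemma split_singular_numbers_bounded:
  fixes A :: "nat \<Rightarrow> 'p::prime_card padic mat"
    and l :: "nat \<Rightarrow> int list" and v :: "nat \<Rightarrow> nat \<Rightarrow> int"
  assumes A: "\<And>k. k \<ge> 1 \<Longrightarrow> A k \<in> carrier_mat n n" "\<And>k. k \<ge> 1 \<Longrightarrow> det (A k) \<noteq> 0"
    and l0: "length (l 0) = n"
    and l: "\<And>k. l (Suc k) = SN (diag_p n n (l k) * A (Suc k))"
    and v: "\<And>k i. 1 \<le> i \<Longrightarrow> i \<le> n \<Longrightarrow>
      (\<Sum>j=i..n. v k j) = (\<Sum>j=1..k. sum_list (SN (last_rows i (A j))))"
    and split: "\<And>i. 1 \<le> i \<Longrightarrow> i \<le> n - 1 \<Longrightarrow>
      filterlim (\<lambda>k. v k i - v (k + 1) (i + 1) + SN (A (k + 1)) ! (n - 1)) at_top sequentially"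
    and i: "i < n"
  shows "bdd_above (range (\<lambda>k. \<bar>l k ! i - v k (Suc i)\<bar>))"
proof -
  \<comment> \<open>The matrices count from 1, so \<open>T k * V k\<close> below factors
    \<open>A (Suc k)\<close>, which leads from time k to time k + 1.\<close>
  note An = A[of "Suc k" for k, simplified]
  have "\<exists>T V. T \<in> carrier_mat n n \<and> upper_triangular T \<and> V \<in> GL_Zp n \<and> A (Suc k) = T * V" for k
    by (rule Iwasawa_decomposition[OF An])
  then obtain T V where T: "\<And>k. T k \<in> carrier_mat n n" "\<And>k. upper_triangular (T k)"
    and V: "\<And>k. V k \<in> GL_Zp n" and ATV: "\<And>k. A (Suc k) = T k * V k"
    by metis
  have detT: "det (T k) \<noteq> 0" for k
    using An(2)[of k] det_mult[OF T(1) GL_ZpD(2)[OF V], of k k] by (auto simp: ATV)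
  have SNA: "is_SN (T k * V k) (SN (A (Suc k)))" for k
    using is_SN_SN[OF An] by (simp add: ATV)
  \<comment> \<open>A coordinate of v is the difference of two consecutive tail sums, and these grow
    by the weights of the corners.\<close>
  have step: "v (Suc k) (Suc j) = v k (Suc j) + pval (T k $$ (j, j))" if j: "j < n" for j k
  proof -
    have tail: "(\<Sum>m=Suc j..n. v (Suc k) m) - (\<Sum>m=Suc j..n. v k m) = (\<Sum>m=j..<n. pval (T k $$ (m, m)))"
      if "j \<le> n" for j
    \<comment> \<open>For \<open>j = n\<close> all sums are empty; this case lies outside the
      hypothesis on v and serves as the tail after the last coordinate.\<close>
    proof (cases "j = n")
      case False
      then show ?thesis
        using that v[of "Suc j" "Suc k"] v[of "Suc j" k]
          weight_SN_last_rows[OF T[of k] detT[of k] V[of k], of "Suc j"]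
        by (simp add: ATV)
    qed simp
    have head: "(\<Sum>m=Suc j..n. v k m) = v k (Suc j) + (\<Sum>m=Suc (Suc j)..n. v k m)" for k
      using j by (subst sum.atLeast_Suc_atMost) auto
    have "(\<Sum>m=j..<n. pval (T k $$ (m, m))) = pval (T k $$ (j, j)) + (\<Sum>m=Suc j..<n. pval (T k $$ (m, m)))"
      using j by (subst sum.atLeast_Suc_lessThan) auto
    then show ?thesis
      using tail[of j] tail[of "Suc j"] j head[of k] head[of "Suc k"] by simp
  qed
  \<comment> \<open>Only finitely many i occur, so a single threshold K serves all of them.\<close>
  have "\<forall>\<^sub>F k in sequentially. \<forall>i\<in>{1..n - 1}. v k i - v (k + 1) (i + 1) + SN (A (k + 1)) ! (n - 1) \<ge> 0"
    using split by (auto intro!: eventually_ball_finite simp: filterlim_at_top)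
  then obtain K where K0: "\<And>k i. k \<ge> K \<Longrightarrow> i \<in> {1..n - 1} \<Longrightarrow>
      v k i - v (k + 1) (i + 1) + SN (A (k + 1)) ! (n - 1) \<ge> 0"
    unfolding eventually_sequentially by blast
  have K: "v k (Suc i) - v (Suc k) (Suc (Suc i)) + SN (A (Suc k)) ! (n - 1) \<ge> 0"
    if "k \<ge> K" "Suc i < n" for k i
    using that K0[of k "Suc i"] by simp
  define w where "w k = map (\<lambda>i. v k (Suc i)) [0..<n]" for k
  have w [simp]: "length (w k) = n" "\<And>i. i < n \<Longrightarrow> w k ! i = v k (Suc i)" for k
    by (simp_all add: w_def)
  \<comment> \<open>From time k to k + 1 the coordinate \<open>Suc (Suc i)\<close> grows by the
    valuation of a diagonal entry, which is at least the smallest singular number. The splitting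
    inequality between times k and k + 1 therefore gives the ordering at time k.\<close>
  have sorted: "sorted_wrt (\<ge>) (w k)" if "k \<ge> K" for k
  proof -
    have "v k (Suc (Suc i)) \<le> v k (Suc i)" if i: "Suc i < n" for i
    proof -
      have "T k $$ (Suc i, Suc i) \<noteq> 0"
        using det_upper_triangular_prod[OF T(2,1)[of k]] detT[of k] i by auto
      then have "SN (A (Suc k)) ! (n - 1) \<le> pval (T k $$ (Suc i, Suc i))"
        using SN_last_le_pval[OF is_SN_mult_right[OF SNA T(1) V] T(1)] i by simp
      then show ?thesis using K[OF \<open>k \<ge> K\<close> i] step[OF i, of k] by simp
    qed
    then show ?thesis
      by (subst sorted_wrt_iff_nth_Suc_transp) (auto simp: transp_def)
  qed
  \<comment> \<open>From time K on, w follows the recursion that defines l.\<close>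
  have SNw: "is_SN (diag_p n n (w k) * A (Suc k)) (w (Suc k))" if "k \<ge> K" for k
    unfolding ATV
  proof (rule is_SN_diag_mult_triangular[OF T detT V SNA])
    show "sorted_wrt (\<ge>) (w (Suc k))" using sorted that by simp
    show "w (Suc k) ! i = w k ! i + pval (T k $$ (i, i))" if "i < n" for i
      using that step by simp
    show "w k ! i - w (Suc k) ! Suc i + SN (A (Suc k)) ! (n - 1) \<ge> 0" if "Suc i < n" for i
      using that K[OF \<open>k \<ge> K\<close>] by simp
  qed simp
  \<comment> \<open>The length is carried through the induction because \<open>det_diag_p\<close>,
    which gives nonsingularity of the next product, requires it.\<close>
  have SNl: "is_SN (diag_p n n (l k) * A (Suc k)) (l (Suc k)) \<and> length (l k) = n" for k
  proof (induction k)
    case 0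
    have "det (diag_p n n (l 0) * A (Suc 0)) \<noteq> 0"
      using det_mult[OF diag_p_carrier An(1), of "l 0" 0] An(2)[of 0] by (simp add: det_diag_p l0)
    then show ?case
      using l0 l[of 0] is_SN_SN[OF mult_carrier_mat[OF diag_p_carrier An(1)]] by simp
  next
    case (Suc k)
    have len: "length (l (Suc k)) = n"
      using Suc is_SNE[OF _ mult_carrier_mat[OF diag_p_carrier An(1)]] by metis
    then have "det (diag_p n n (l (Suc k)) * A (Suc (Suc k))) \<noteq> 0"
      using det_mult[OF diag_p_carrier An(1), of "l (Suc k)" "Suc k"] An(2)[of "Suc k"]
      by (simp add: det_diag_p)
    then show ?case
      using len l[of "Suc k"] is_SN_SN[OF mult_carrier_mat[OF diag_p_carrier An(1)]] by simp
  qed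
  \<comment> \<open>A common bound for all coordinates at time K; the Lipschitz property propagates
    this same constant to all later times.\<close>
  define c where "c = (\<Sum>i<n. \<bar>l K ! i - w K ! i\<bar>)"
  have bound: "\<forall>i<n. \<bar>l k ! i - w k ! i\<bar> \<le> c" if "k \<ge> K" for k
    using that
  proof (induction k rule: dec_induct)
    case base
    show ?case unfolding c_def by (auto intro!: member_le_sum)
  next
    case (step k)
    have "l (Suc k) ! i \<le> w (Suc k) ! i + c" if "i < n" for i
      by (rule SN_diag_mult_shift_mono[OF An(1) conjunct1[OF SNl] SNw[OF step.hyps(1)] _ that])
        (use step.IH in \<open>force simp del: w\<close>)
    moreover have "w (Suc k) ! i \<le> l (Suc k) ! i + c" if "i < n" for i
      by (rule SN_diag_mult_shift_mono[OF An(1) SNw[OF step.hyps(1)] conjunct1[OF SNl] _ that])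
        (use step.IH in \<open>force simp del: w\<close>)
    ultimately show ?case by (smt (verit))
  qed
  have c0: "c \<ge> 0" by (simp add: c_def sum_nonneg)
  show ?thesis
  proof (rule bdd_aboveI2)
    fix k
    let ?f = "\<lambda>k. \<bar>l k ! i - v k (Suc i)\<bar>"
    \<comment> \<open>The finitely many times before K are bounded by their sum, all later ones by
      c; both summands are nonnegative.\<close>
    show "?f k \<le> c + (\<Sum>k<K. ?f k)"
    proof (cases "k < K")
      case True
      then have "?f k \<le> (\<Sum>k<K. ?f k)" by (intro member_le_sum) auto
      then show ?thesis using c0 by simp
    next
      case False
      then have "?f k \<le> c" using bound[of k] i by simp
      moreover have "0 \<le> (\<Sum>k<K. ?f k)" by (rule sum_nonneg) simp
      ultimately show ?thesis by linarith
    qed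
  qed
qed

section \<open>Transfer to a given outcome of the probability space\<close>

theorem theorem3p4:
  fixes M :: "'w measure"
    and n :: nat
    and A :: "nat \<Rightarrow> 'w \<Rightarrow> 'p::prime_card padic mat"
    and lam :: "nat \<Rightarrow> 'w \<Rightarrow> int list"
    and v :: "nat \<Rightarrow> 'w \<Rightarrow> nat \<Rightarrow> int"
    and \<omega> :: 'w
  assumes "prob_space M"
    and "n \<ge> 1"
    and "prob_space.indep_vars M (\<lambda>_. borel_GL n) A {1..}"
    and "\<And>k. k \<ge> 1 \<Longrightarrow> GL_Zp_bi_invariant n (distr M (borel_GL n) (A k))"
    and lam_0: "\<And>x. x \<in> space M \<Longrightarrow> lam 0 x = replicate n 0"
    and lam_k: "\<And>x k. x \<in> space M \<Longrightarrow> k \<ge> 1 \<Longrightarrow>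
                  lam k x = SN (diag_p n n (lam (k - 1) x) * A k x)"
    and v: "\<And>x k i. x \<in> space M \<Longrightarrow> 1 \<le> i \<Longrightarrow> i \<le> n \<Longrightarrow>
                  (\<Sum>j=i..n. v k x j) = (\<Sum>j=1..k. sum_list (SN (last_rows i (A j x))))"
    and "\<omega> \<in> space M"
    and split: "\<And>i. 1 \<le> i \<Longrightarrow> i \<le> n - 1 \<Longrightarrow>
                  filterlim (\<lambda>k. v k \<omega> i - v (k + 1) \<omega> (i + 1) + SN (A (k + 1) \<omega>) ! (n - 1))
                    at_top sequentially"
  shows "\<forall>i\<in>{1..n}. bdd_above (range (\<lambda>k. \<bar>lam k \<omega> ! (i - 1) - v k \<omega> i\<bar>))"
proof
  fix i assume i: "i \<in> {1..n}"
  interpret prob_space M by fact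
  have "A k \<omega> \<in> GL n" if "k \<ge> 1" for k
  proof -
    \<comment> \<open>Independence includes measurability into \<open>borel_GL n\<close>, whose
      space is \<open>GL_Qp n\<close>; hence each \<open>A k \<omega>\<close> is invertible.\<close>
    have "random_variable (borel_GL n) (A k)"
      using assms(3) that unfolding indep_vars_def by auto
    then have "A k \<omega> \<in> space (borel_GL n)"
      using assms(8) by (rule measurable_space)
    then show ?thesis by (simp add: borel_GL_def)
  qed
  then have "A k \<omega> \<in> carrier_mat n n" "det (A k \<omega>) \<noteq> 0" if "k \<ge> 1" for k
    using that det_dvd_1_if_GL[of "A k \<omega>" n] by (auto simp: GL_def)
  then have "bdd_above (range (\<lambda>k. \<bar>lam k \<omega> ! (i - 1) - v k \<omega> (Suc (i - 1))\<bar>))"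
    using assms(8) i lam_0 lam_k[of \<omega> "Suc k" for k] v[OF assms(8)] split
    by (intro split_singular_numbers_bounded[where A = "\<lambda>k. A k \<omega>" and n = n]) auto
  then show "bdd_above (range (\<lambda>k. \<bar>lam k \<omega> ! (i - 1) - v k \<omega> i\<bar>))"
    using i by simp
qed

end
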